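(* Let $\star\in\{\mathsf T,\mathsf H\}$, let $n,r\ge1$, and let $A_k,B_k,C_k,D_k,E_k\in\mathbb{C}^{n\times n}$ for $k=1,\dots,r$. The system $$\left\{\begin{array}{ll} A_kX_kB_k-C_kX_{k+1}D_k=E_k, & k=1,\dots,r-1,\\ A_rX_rB_r-C_rX_1^\star D_r=E_r,\end{array}\right.$$ in the unknowns $X_1,\dots,X_r\in\mathbb{C}^{n\times n}$, is nonsingular if and only if the formal matrix product $$\Pi=D_r^{-\star}B_r^\star D_{r-1}^{-\star}B_{r-1}^\star\cdots D_1^{-\star}B_1^\star\,C_r^{-1}A_rC_{r-1}^{-1}A_{r-1}\cdots C_1^{-1}A_1$$ is regular and: - if $\star=\mathsf H$, then $\Lambda(\Pi)$ is an $\mathsf H$-reciprocal free set; - if $\star=\mathsf T$, then $\Lambda(\Pi)\setminus\{-1\}$ is a reciprocal free set, and the multiplicity of $\lambda=-1$ as an eigenvalue of $\Pi$ is at most $1$.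
   Context: $\mathsf T$ denotes transpose and $\mathsf H$ conjugate transpose; $M^{-\star}$ denotes $(M^\star)^{-1}$ (formally). A system of matrix equations is called nonsingular if it has a unique solution for every choice of the right-hand sides $E_1,\dots,E_r$. Formal matrix products (no matrix is assumed invertible). By the periodic Schur decomposition theorem, for any $M_k,N_k\in\mathbb{C}^{n\times n}$, $k=1,\dots,p$, there are unitary $Q_k,Z_k$ such that $Q_k^{\mathsf H}M_kZ_k=T_k$ and $Q_k^{\mathsf H}N_kZ_{k+1}=R_k$ are upper triangular for $k=1,\dots,p$, with $Z_{p+1}=Z_1$. The formal product $N_p^{-1}M_pN_{p-1}^{-1}M_{p-1}\cdots N_1^{-1}M_1$ is called singular if for some $i\in\{1,\dots,n\}$ one has $\prod_{k=1}^p(T_k)_{ii}=\prod_{k=1}^p(R_k)_{ii}=0$, and regular otherwise. If it is regular, its eigenvalues are $$\lambda_i=\frac{\prod_{k=1}^p(T_k)_{ii}}{\prod_{k=1}^p(R_k)_{ii}}\in\mathbb{C}\cup\{\infty\},\qquad i=1,\dots,n,$$ with $a/0=\infty$ for $a\ne0$. (These notions do not depend on the chosen decomposition.) The multiplicity of $\lambda$ is the number of indices $i$ with $\lambda_i=\lambda$, and the spectrum $\Lambda(\cdot)$ is the set of eigenvalues. The product $\Pi$ of the claim is the case $p=2r$, with $M_k=A_k$, $N_k=C_k$, $M_{r+k}=B_k^\star$, $N_{r+k}=D_k^\star$ for $k=1,\dots,r$. A set $\mathcal S\subseteq\mathbb{C}\cup\{\infty\}$ is reciprocal free if $\lambda\ne\mu^{-1}$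 for all $\lambda,\mu\in\mathcal S$ (including $\lambda=\mu$), and $\mathsf H$-reciprocal free if $\lambda\ne(\overline\mu)^{-1}$ for all $\lambda,\mu\in\mathcal S$ (including $\lambda=\mu$), with the conventions $0^{-1}=\infty$, $\infty^{-1}=0$, $\overline\infty=\infty$. *)

theory Defs
  imports "HOL-Library.FuncSet" "Jordan_Normal_Form.Schur_Decomposition"
begin

text \<open>
  Families \<open>M\<^sub>1, \<dots>, M\<^sub>p\<close> of matrices are functions on \<open>nat\<close>, of which only the values at
  \<open>{1..p}\<close> matter. Entries of a single matrix are indexed by \<open>{0..<n}\<close>, as in the library.
\<close>

datatype star_op = Transpose | Adjoint

fun star_mat :: "star_op \<Rightarrow> complex mat \<Rightarrow> complex mat" where
  "star_mat Transpose M = transpose_mat M"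
| "star_mat Adjoint M = mat_adjoint M"

definition unitary_mat :: "nat \<Rightarrow> complex mat \<Rightarrow> bool" where
  "unitary_mat n U \<longleftrightarrow> U \<in> carrier_mat n n \<and> mat_adjoint U * U = 1\<^sub>m n"


subsection \<open>Systems of generalized Sylvester equations\<close>

definition solves_system ::
  "star_op \<Rightarrow> nat \<Rightarrow> (nat \<Rightarrow> complex mat) \<Rightarrow> (nat \<Rightarrow> complex mat) \<Rightarrow> (nat \<Rightarrow> complex mat) \<Rightarrow>
   (nat \<Rightarrow> complex mat) \<Rightarrow> (nat \<Rightarrow> complex mat) \<Rightarrow> (nat \<Rightarrow> complex mat) \<Rightarrow> bool" where
  "solves_system s r A B C D E X \<longleftrightarrow>
     (\<forall>k\<in>{1..<r}. A k * X k * B k - C k * X (k + 1) * D k = E k) \<and>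
     A r * X r * B r - C r * star_mat s (X 1) * D r = E r"

text \<open>
  The extensional function space \<open>\<rightarrow>\<^sub>E\<close> fixes the irrelevant values of \<open>X\<close> outside \<open>{1..r}\<close>, so
  that \<open>\<exists>!\<close> expresses uniqueness of the tuple \<open>(X\<^sub>1, \<dots>, X\<^sub>r)\<close>.
\<close>

definition nonsingular_system ::
  "star_op \<Rightarrow> nat \<Rightarrow> nat \<Rightarrow> (nat \<Rightarrow> complex mat) \<Rightarrow> (nat \<Rightarrow> complex mat) \<Rightarrow>
   (nat \<Rightarrow> complex mat) \<Rightarrow> (nat \<Rightarrow> complex mat) \<Rightarrow> bool" where
  "nonsingular_system s n r A B C D \<longleftrightarrow>
     (\<forall>E. (\<forall>k\<in>{1..r}. E k \<in> carrier_mat n n) \<longrightarrow>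
       (\<exists>!X. X \<in> {1..r} \<rightarrow>\<^sub>E carrier_mat n n \<and> solves_system s r A B C D E X))"


subsection \<open>The extended complex plane\<close>

datatype ext_complex = Fin complex | Infty

fun ext_inverse :: "ext_complex \<Rightarrow> ext_complex" where
  "ext_inverse (Fin z) = (if z = 0 then Infty else Fin (inverse z))"
| "ext_inverse Infty = Fin 0"

fun ext_cnj :: "ext_complex \<Rightarrow> ext_complex" where
  "ext_cnj (Fin z) = Fin (cnj z)"
| "ext_cnj Infty = Infty"

text \<open>The value for \<open>a = b = 0\<close> is irrelevant: it does not arise for regular products.\<close>

definition ext_divide :: "complex \<Rightarrow> complex \<Rightarrow> ext_complex" where
  "ext_divide a b = (if b = 0 then Infty else Fin (a / b))"

definition reciprocal_free :: "ext_complex set \<Rightarrow> bool" where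
  "reciprocal_free S \<longleftrightarrow> (\<forall>x\<in>S. \<forall>y\<in>S. x \<noteq> ext_inverse y)"

definition H_reciprocal_free :: "ext_complex set \<Rightarrow> bool" where
  "H_reciprocal_free S \<longleftrightarrow> (\<forall>x\<in>S. \<forall>y\<in>S. x \<noteq> ext_inverse (ext_cnj y))"


subsection \<open>Formal matrix products\<close>

text \<open>
  A pair of families \<open>(M, N)\<close> represents the formal product
  \<open>N\<^sub>p\<^sup>-\<^sup>1 M\<^sub>p \<cdots> N\<^sub>1\<^sup>-\<^sup>1 M\<^sub>1\<close>; the \<open>N\<^sub>k\<close> need not be invertible.
\<close>

definition periodic_schur ::
  "nat \<Rightarrow> nat \<Rightarrow> (nat \<Rightarrow> complex mat) \<Rightarrow> (nat \<Rightarrow> complex mat) \<Rightarrow> (nat \<Rightarrow> complex mat) \<Rightarrow>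
   (nat \<Rightarrow> complex mat) \<Rightarrow> (nat \<Rightarrow> complex mat) \<Rightarrow> (nat \<Rightarrow> complex mat) \<Rightarrow> bool" where
  "periodic_schur n p M N Q Z T R \<longleftrightarrow>
     Z (p + 1) = Z 1 \<and>
     (\<forall>k\<in>{1..p}.
        unitary_mat n (Q k) \<and> unitary_mat n (Z k) \<and>
        mat_adjoint (Q k) * M k * Z k = T k \<and> upper_triangular (T k) \<and>
        mat_adjoint (Q k) * N k * Z (k + 1) = R k \<and> upper_triangular (R k))"

text \<open>
  The triangular factors \<open>(T, R)\<close> of some periodic Schur decomposition. One exists for all
  families of \<open>n \<times> n\<close> matrices by the periodic Schur decomposition theorem, and the notions
  derived below (regularity, spectrum, multiplicities) do not depend on the choice.
\<close>

definition schur_factors ::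
  "nat \<Rightarrow> nat \<Rightarrow> (nat \<Rightarrow> complex mat) \<Rightarrow> (nat \<Rightarrow> complex mat) \<Rightarrow>
   (nat \<Rightarrow> complex mat) \<times> (nat \<Rightarrow> complex mat)" where
  "schur_factors n p M N = (SOME TR. \<exists>Q Z. periodic_schur n p M N Q Z (fst TR) (snd TR))"

definition num_diag ::
  "nat \<Rightarrow> nat \<Rightarrow> (nat \<Rightarrow> complex mat) \<Rightarrow> (nat \<Rightarrow> complex mat) \<Rightarrow> nat \<Rightarrow> complex" where
  "num_diag n p M N i = (\<Prod>k=1..p. fst (schur_factors n p M N) k $$ (i, i))"

definition den_diag ::
  "nat \<Rightarrow> nat \<Rightarrow> (nat \<Rightarrow> complex mat) \<Rightarrow> (nat \<Rightarrow> complex mat) \<Rightarrow> nat \<Rightarrow> complex" where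
  "den_diag n p M N i = (\<Prod>k=1..p. snd (schur_factors n p M N) k $$ (i, i))"

definition regular_product ::
  "nat \<Rightarrow> nat \<Rightarrow> (nat \<Rightarrow> complex mat) \<Rightarrow> (nat \<Rightarrow> complex mat) \<Rightarrow> bool" where
  "regular_product n p M N \<longleftrightarrow> \<not> (\<exists>i<n. num_diag n p M N i = 0 \<and> den_diag n p M N i = 0)"

definition product_eigenvalue ::
  "nat \<Rightarrow> nat \<Rightarrow> (nat \<Rightarrow> complex mat) \<Rightarrow> (nat \<Rightarrow> complex mat) \<Rightarrow> nat \<Rightarrow> ext_complex" where
  "product_eigenvalue n p M N i = ext_divide (num_diag n p M N i) (den_diag n p M N i)"

definition product_spectrum ::
  "nat \<Rightarrow> nat \<Rightarrow> (nat \<Rightarrow> complex mat) \<Rightarrow> (nat \<Rightarrow> complex mat) \<Rightarrow> ext_complex set" where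
  "product_spectrum n p M N = product_eigenvalue n p M N ` {0..<n}"

definition product_multiplicity ::
  "nat \<Rightarrow> nat \<Rightarrow> (nat \<Rightarrow> complex mat) \<Rightarrow> (nat \<Rightarrow> complex mat) \<Rightarrow> ext_complex \<Rightarrow> nat" where
  "product_multiplicity n p M N x = card {i. i < n \<and> product_eigenvalue n p M N i = x}"

text \<open>
  \<open>join_star s r A B\<close> is the family \<open>A\<^sub>1, \<dots>, A\<^sub>r, B\<^sub>1\<^sup>\<star>, \<dots>, B\<^sub>r\<^sup>\<star>\<close> of length \<open>2 * r\<close>.
\<close>

definition join_star ::
  "star_op \<Rightarrow> nat \<Rightarrow> (nat \<Rightarrow> complex mat) \<Rightarrow> (nat \<Rightarrow> complex mat) \<Rightarrow> nat \<Rightarrow> complex mat" where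
  "join_star s r A B k = (if k \<le> r then A k else star_mat s (B (k - r)))"

end

theory Submission
  imports Defs "Jordan_Normal_Form.Spectral_Radius"
begin

text \<open>
  The unknowns are continued beyond \<open>X\<^sub>r\<close> by \<open>X (k + r) = X k\<^sup>\<star>\<close>. With
  \<open>M = (A\<^sub>1, \<dots>, A\<^sub>r, B\<^sub>1\<^sup>\<star>, \<dots>, B\<^sub>r\<^sup>\<star>)\<close> and \<open>N = (C\<^sub>1, \<dots>, C\<^sub>r, D\<^sub>1\<^sup>\<star>, \<dots>, D\<^sub>r\<^sup>\<star>)\<close>, both repeated with
  period \<open>2 * r\<close>, the system together with its starred copy becomes the single equation
  \<open>M k * X k * M (k + r)\<^sup>\<star> - N k * X (k + 1) * N (k + r)\<^sup>\<star> = E k\<close> for all \<open>k\<close>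
  (\<open>nonsingular_iff_twisted_nonsingular\<close>). A periodic Schur decomposition of \<open>(M, N)\<close> is an
  invertible change of variables that preserves this form and makes the coefficients upper
  triangular (\<open>periodic_schur_exists\<close>, \<open>twisted_nonsingular_conj\<close>).

  For triangular coefficients, the equation for the entries at \<open>(i, j)\<close> involves only entries at
  positions \<open>(a, b)\<close> with \<open>a \<ge> i\<close> and \<open>b \<ge> j\<close>, while the star exchanges \<open>(i, j)\<close> and \<open>(j, i)\<close>. Ordered
  by \<open>i + j\<close>, the system is block triangular, and it is nonsingular if and only if all its diagonal
  blocks are. Since the adjoint is only semilinear, the system has no determinant over the complex
  numbers; instead, back substitution yields solutions, and a singular block of minimal \<open>i + j\<close>
  yields a nonzero element of the kernel (\<open>extend_solution\<close>, \<open>triangular_kernel\<close>).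

  The diagonal block at \<open>(i, j)\<close> is a cyclic scalar system
  \<open>a k * w k - b k * w (k + 1) = f k\<close>, which is nonsingular if and only if \<open>\<Prod>a \<noteq> \<Prod>b\<close>
  (\<open>cyclic_solution\<close>, \<open>cyclic_unique\<close>, \<open>cyclic_kernel\<close>). For the eigenvalues
  \<open>\<lambda>\<^sub>i = \<alpha>\<^sub>i / \<beta>\<^sub>i\<close>, quotients of products of diagonal entries, this says \<open>\<alpha>\<^sub>i * \<alpha>\<^sub>j \<noteq> \<beta>\<^sub>i * \<beta>\<^sub>j\<close> for the transpose and
  \<open>i \<noteq> j\<close>, and the same with \<open>\<alpha>\<^sub>j\<close> and \<open>\<beta>\<^sub>j\<close> conjugated for the adjoint and all \<open>i, j\<close>; this is regularity
  together with the absence of reciprocal pairs. For the transpose and \<open>i = j\<close> the cycle has length \<open>r\<close>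
  instead of \<open>2 * r\<close>, and the condition is only \<open>\<alpha>\<^sub>i \<noteq> \<beta>\<^sub>i\<close>: a simple eigenvalue \<open>- 1\<close> is harmless.
\<close>

section \<open>Periodic families\<close>

lemma periodic_add_mult:
  fixes f :: "nat \<Rightarrow> 'a"
  assumes "\<And>k. f (k + p) = f k"
  shows "f (k + m * p) = f k"
proof (induction m)
  case (Suc m)
  then show ?case using assms[of "k + m * p"] by (simp add: algebra_simps)
qed simp

lemma periodic_mod:
  fixes f :: "nat \<Rightarrow> 'a"
  assumes "\<And>k. f (k + p) = f k"
  shows "f (k mod p) = f k"
  using periodic_add_mult[of f p "k mod p" "k div p", OF assms] by simp

text \<open>
  The map \<open>k \<mapsto> k * (p - 1)\<close> is \<open>k \<mapsto> - k\<close> modulo \<open>p\<close>, written without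
  negative numbers. It is used to run through a cycle in the opposite direction.
\<close>

lemma periodic_reverse_twice:
  fixes f :: "nat \<Rightarrow> 'a"
  assumes p: "0 < p" and per: "\<And>k. f (k + p) = f k"
  shows "f (k * (p - 1) * (p - 1)) = f k"
proof (cases "2 \<le> p")
  case True
  then obtain m where m: "p = Suc (Suc m)" by (metis add_2_eq_Suc le_Suc_ex)
  have "k * (p - 1) * (p - 1) = k + (k * m) * p" unfolding m by (simp add: algebra_simps)
  then show ?thesis using periodic_add_mult[of f p k "k * m", OF per] by simp
next
  case False
  then have "p = 1" using p by simp
  then show ?thesis using periodic_add_mult[of f p 0 k, OF per] by simp
qed

text \<open>
  A walk of length \<open>p\<close> that starts at an arbitrary position \<open>c\<close> of a \<open>p\<close>-periodic
  sequence of relations and returns to its first point is a closed walk of the whole cycle. This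
  allows a cycle to be cut open wherever a coefficient or a determinant vanishes.
\<close>

lemma close_cycle:
  fixes G :: "nat \<Rightarrow> 'a \<Rightarrow> 'a \<Rightarrow> bool"
  assumes p: "0 < p" and per: "\<And>k. G (k + p) = G k"
    and steps: "\<And>i. Suc i < p \<Longrightarrow> G (c + i) (v i) (v (Suc i))"
    and closing: "G (c + (p - 1)) (v (p - 1)) (v 0)"
  obtains z where "\<And>k. z (k + p) = z k" "\<And>k. G k (z k) (z (Suc k))"
    "\<And>i. i < p \<Longrightarrow> z (c + i) = v i"
proof -
  \<comment> \<open>Shift the indices by \<open>j\<close>, the additive inverse of \<open>c\<close> modulo \<open>p\<close>.\<close>
  define j where "j = c * (p - 1)"
  define z where "z k = v ((k + j) mod p)" for k
  have cj: "c + j = c * p" unfolding j_def using p by (cases p) auto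
  have zc: "z (c + i) = v i" if "i < p" for i
  proof -
    have "c + i + j = i + c * p" using cj by simp
    then have "(c + i + j) mod p = i mod p" by (metis mod_mult_self1)
    then show ?thesis unfolding z_def using that by simp
  qed
  have zp: "z (k + p) = z k" for k
  proof -
    have "k + p + j = (k + j) + p" by simp
    then show ?thesis unfolding z_def by (metis mod_add_self2)
  qed
  have zG: "G k (z k) (z (Suc k))" for k
  proof -
    define i where "i = (k + j) mod p"
    have ip: "i < p" using p unfolding i_def by simp
    have "(c + i) mod p = (c + (k + j)) mod p" unfolding i_def by (rule mod_add_right_eq)
    also have "c + (k + j) = k + c * p" using cj by simp
    also have "\<dots> mod p = k mod p" by simp
    finally have Gk: "G (c + i) = G k" using periodic_mod[of G p, OF per] by metis
    have nxt: "(Suc k + j) mod p = (if Suc i < p then Suc i else 0)"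
    proof -
      have "(Suc k + j) mod p = Suc i mod p" unfolding i_def by (simp add: mod_Suc_eq)
      then show ?thesis using ip by (auto simp: mod_Suc)
    qed
    show ?thesis
    proof (cases "Suc i < p")
      case True
      then show ?thesis using steps[OF True] nxt Gk unfolding z_def i_def[symmetric] by simp
    next
      case False
      then have "i = p - 1" using ip by simp
      then show ?thesis using closing nxt Gk False unfolding z_def i_def[symmetric] by simp
    qed
  qed
  show thesis using that[OF zp zG zc] .
qed

section \<open>Unitary matrices\<close>

lemma adjoint_carrier [simp]: "A \<in> carrier_mat m n \<Longrightarrow> mat_adjoint A \<in> carrier_mat n m"
  unfolding mat_adjoint_def by auto

lemma adjoint_dims [simp]: "dim_row (mat_adjoint A) = dim_col A" "dim_col (mat_adjoint A) = dim_row A"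
  unfolding mat_adjoint_def by auto

lemma adjoint_index [simp]:
  "i < dim_col A \<Longrightarrow> j < dim_row A \<Longrightarrow> mat_adjoint A $$ (i, j) = conjugate (A $$ (j, i))"
  unfolding mat_adjoint_def by (simp add: mat_of_rows_index)

lemma adjoint_four_block:
  assumes "A \<in> carrier_mat nr1 nc1" "B \<in> carrier_mat nr1 nc2"
    "C \<in> carrier_mat nr2 nc1" "D \<in> carrier_mat nr2 nc2"
  shows "mat_adjoint (four_block_mat A B C D) =
    four_block_mat (mat_adjoint A) (mat_adjoint C) (mat_adjoint B) (mat_adjoint D)"
  by (rule eq_matI, insert assms, auto)

lemma adjoint_mult:
  fixes A B :: "complex mat"
  assumes "A \<in> carrier_mat m n" "B \<in> carrier_mat n l"
  shows "mat_adjoint (A * B) = mat_adjoint B * mat_adjoint A"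
  by (rule eq_matI, insert assms, auto simp: scalar_prod_def mult.commute intro!: sum.cong)

lemma unitary_carrier [simp]: "unitary_mat n U \<Longrightarrow> U \<in> carrier_mat n n"
  unfolding unitary_mat_def by simp

lemma unitary_left: "unitary_mat n U \<Longrightarrow> mat_adjoint U * U = 1\<^sub>m n"
  unfolding unitary_mat_def by simp

lemma unitary_right: "unitary_mat n U \<Longrightarrow> U * mat_adjoint U = 1\<^sub>m n"
  using mat_mult_left_right_inverse[of "mat_adjoint U" n U] unfolding unitary_mat_def by simp

lemma unitary_mult:
  assumes "unitary_mat n U" "unitary_mat n V"
  shows "unitary_mat n (U * V)"
proof -
  note [simp] = unitary_carrier[OF assms(1)] unitary_carrier[OF assms(2)]
  have c: "mat_adjoint U \<in> carrier_mat n n" "mat_adjoint V \<in> carrier_mat n n"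
    "U * V \<in> carrier_mat n n" by (auto intro!: mult_carrier_mat[of _ n n])
  have "mat_adjoint (U * V) * (U * V) = mat_adjoint V * mat_adjoint U * (U * V)"
    by (simp add: adjoint_mult[of U n n V n])
  also have "\<dots> = mat_adjoint V * (mat_adjoint U * U * V)"
    using assoc_mult_mat[OF c(2,1,3)] assoc_mult_mat[OF c(1) unitary_carrier[OF assms(1)] unitary_carrier[OF assms(2)]]
    by simp
  also have "\<dots> = 1\<^sub>m n"
    using assms left_mult_one_mat[OF unitary_carrier[OF assms(2)]] by (simp add: unitary_left)
  finally show ?thesis unfolding unitary_mat_def using c(3) by simp
qed

lemma unitary_block:
  assumes "unitary_mat n U"
  shows "unitary_mat (Suc n) (four_block_mat (1\<^sub>m 1) (0\<^sub>m 1 n) (0\<^sub>m n 1) U)"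
proof -
  note [simp] = unitary_carrier[OF assms]
  have adj: "mat_adjoint (1\<^sub>m 1) = (1\<^sub>m 1 :: complex mat)"
    "mat_adjoint (0\<^sub>m 1 n) = (0\<^sub>m n 1 :: complex mat)"
    "mat_adjoint (0\<^sub>m n 1) = (0\<^sub>m 1 n :: complex mat)"
    by (rule eq_matI; simp)+
  let ?O = "1\<^sub>m 1 :: complex mat" and ?r = "0\<^sub>m 1 n :: complex mat" and ?c = "0\<^sub>m n 1 :: complex mat"
  have "mat_adjoint (four_block_mat ?O ?r ?c U) = four_block_mat ?O ?r ?c (mat_adjoint U)"
    using adjoint_four_block[of ?O 1 1 ?r n ?c n U] unfolding adj by simp
  moreover have "four_block_mat ?O ?r ?c (mat_adjoint U) * four_block_mat ?O ?r ?c U = 1\<^sub>m (1 + n)"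
    using mult_four_block_mat[of ?O 1 1 ?r n ?c n "mat_adjoint U" ?O 1 ?r n ?c U] assms
    by (simp add: unitary_left left_mult_zero_mat[of U n n] right_mult_zero_mat[of "mat_adjoint U" n n] del: One_nat_def)
  moreover have "four_block_mat ?O ?r ?c U \<in> carrier_mat (1 + n) (1 + n)"
    by (rule four_block_carrier_mat) simp_all
  ultimately show ?thesis unfolding unitary_mat_def by simp
qed

text \<open>
  Completing \<open>z\<close> to a basis, applying the Gram-Schmidt process (which does not change the
  first vector) and scaling the orthogonal vectors to length one gives the columns of \<open>U\<close>.
\<close>

lemma unitary_with_first_column:
  fixes z :: "complex vec"
  assumes z: "z \<in> carrier_vec n" "z \<noteq> 0\<^sub>v n"
  obtains U c where "unitary_mat n U" "z = c \<cdot>\<^sub>v col U 0"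
proof -
  interpret cof_vec_space n "TYPE(complex)" .
  define ws where "ws = gram_schmidt n (basis_completion z)"
  note bc = basis_completion[OF z]
  note gs = gram_schmidt_result[OF bc(2) bc(4) bc(5) ws_def]
  have len: "length ws = n" using gs(4) bc(6) by simp
  have n0: "0 < n" using z by (cases n) auto
  have hd: "ws ! 0 = z"
  proof -
    obtain bs where bs: "basis_completion z = z # bs"
      using bc(6,7) n0 by (cases "basis_completion z") auto
    have "hd ws = z" unfolding ws_def bs by (rule gram_schmidt_hd[OF z(1)])
    then show ?thesis using len n0 by (cases ws) auto
  qed
  have wsc: "i < n \<Longrightarrow> ws ! i \<in> carrier_vec n" for i using gs(3) len by auto
  define l where "l i = sqrt (Re (ws ! i \<bullet>c ws ! i))" for i
  have l: "complex_of_real (l i) * complex_of_real (l i) = ws ! i \<bullet>c ws ! i" "l i \<noteq> 0" if i: "i < n" for i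
  proof -
    have nz: "ws ! i \<bullet>c ws ! i \<noteq> 0" using corthogonalD[OF gs(2), of i i] i len by simp
    have "ws ! i \<bullet>c ws ! i \<ge> 0" by (rule conjugate_square_ge_0_vec)
    then have re: "0 \<le> Re (ws ! i \<bullet>c ws ! i)" and im: "Im (ws ! i \<bullet>c ws ! i) = 0"
      by (auto simp: less_eq_complex_def)
    then have e: "ws ! i \<bullet>c ws ! i = complex_of_real (Re (ws ! i \<bullet>c ws ! i))"
      by (simp add: complex_eq_iff)
    show "complex_of_real (l i) * complex_of_real (l i) = ws ! i \<bullet>c ws ! i"
      unfolding l_def of_real_mult[symmetric] using re e by simp
    then show "l i \<noteq> 0" using nz by auto
  qed
  define U where "U = mat n n (\<lambda>(i,j). ws ! j $ i / complex_of_real (l j))"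
  have U: "U \<in> carrier_mat n n" unfolding U_def by simp
  have "mat_adjoint U * U = 1\<^sub>m n"
  proof (rule eq_matI)
    fix i j assume "i < dim_row (1\<^sub>m n)" "j < dim_col (1\<^sub>m n)"
    then have ij: "i < n" "j < n" by auto
    have "(mat_adjoint U * U) $$ (i, j) =
      (\<Sum>k<n. cnj (ws ! i $ k / complex_of_real (l i)) * (ws ! j $ k / complex_of_real (l j)))"
      using ij U by (auto simp: scalar_prod_def U_def atLeast0LessThan)
    also have "\<dots> = (\<Sum>k<n. ws ! j $ k * cnj (ws ! i $ k)) / (complex_of_real (l i) * complex_of_real (l j))"
      unfolding sum_divide_distrib by (rule sum.cong) auto
    also have "(\<Sum>k<n. ws ! j $ k * cnj (ws ! i $ k)) = ws ! j \<bullet>c ws ! i"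
      using wsc[OF ij(1)] wsc[OF ij(2)] by (auto simp: scalar_prod_def atLeast0LessThan)
    also have "\<dots> / (complex_of_real (l i) * complex_of_real (l j)) = (if i = j then 1 else 0)"
      using corthogonalD[OF gs(2), of j i] ij len l[OF ij(1)] by auto
    finally show "(mat_adjoint U * U) $$ (i, j) = 1\<^sub>m n $$ (i, j)" using ij by simp
  qed (use U in auto)
  then have "unitary_mat n U" using U unfolding unitary_mat_def by simp
  moreover have "z = complex_of_real (l 0) \<cdot>\<^sub>v col U 0"
    by (rule eq_vecI) (use z n0 l(2)[OF n0] hd in \<open>auto simp: U_def\<close>)
  ultimately show thesis by (rule that)
qed

section \<open>The periodic Schur decomposition\<close>

text \<open>
  A cycle of vectors related in this way is a periodic deflating line, the substitute for an
  eigenvector of the formal product \<open>N\<^sub>p\<^sup>-\<^sup>1 M\<^sub>p \<cdots> N\<^sub>1\<^sup>-\<^sup>1 M\<^sub>1\<close>. If \<open>N\<close> is invertible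
  and \<open>M x \<noteq> 0\<close>, the relation says that \<open>y\<close> spans the line of \<open>N\<^sup>-\<^sup>1 M x\<close>; requiring only that
  \<open>M x\<close> and \<open>N y\<close> lie on a common line makes sense for singular matrices, too.
\<close>

definition step_related :: "nat \<Rightarrow> complex mat \<Rightarrow> complex mat \<Rightarrow> complex vec \<Rightarrow> complex vec \<Rightarrow> bool" where
  "step_related n M N x y \<longleftrightarrow>
     x \<in> carrier_vec n \<and> x \<noteq> 0\<^sub>v n \<and> y \<in> carrier_vec n \<and> y \<noteq> 0\<^sub>v n \<and>
     (\<exists>q t r. q \<in> carrier_vec n \<and> q \<noteq> 0\<^sub>v n \<and> M *\<^sub>v x = t \<cdot>\<^sub>v q \<and> N *\<^sub>v y = r \<cdot>\<^sub>v q)"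

lemma step_related_swap: "step_related n M N x y \<longleftrightarrow> step_related n N M y x"
  unfolding step_related_def by blast

lemma step_related_kernel:
  assumes "M \<in> carrier_mat n n" "N \<in> carrier_mat n n"
    and "x \<in> carrier_vec n" "x \<noteq> 0\<^sub>v n" "y \<in> carrier_vec n" "y \<noteq> 0\<^sub>v n" "N *\<^sub>v y = 0\<^sub>v n"
  shows "step_related n M N x y"
proof -
  have "\<exists>q t r. q \<in> carrier_vec n \<and> q \<noteq> 0\<^sub>v n \<and> M *\<^sub>v x = t \<cdot>\<^sub>v q \<and> N *\<^sub>v y = r \<cdot>\<^sub>v q"
  proof (cases "M *\<^sub>v x = 0\<^sub>v n")
    case True
    then have "M *\<^sub>v x = 0 \<cdot>\<^sub>v x" "N *\<^sub>v y = 0 \<cdot>\<^sub>v x" using assms by auto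
    then show ?thesis using assms by blast
  next
    case False
    have "M *\<^sub>v x = 1 \<cdot>\<^sub>v (M *\<^sub>v x)" "N *\<^sub>v y = 0 \<cdot>\<^sub>v (M *\<^sub>v x)" "M *\<^sub>v x \<in> carrier_vec n"
      using assms by auto
    then show ?thesis using False by blast
  qed
  then show ?thesis unfolding step_related_def using assms by blast
qed

lemma inverse_exists:
  fixes N :: "complex mat"
  assumes "N \<in> carrier_mat n n" "det N \<noteq> 0"
  obtains J where "J \<in> carrier_mat n n" "N * J = 1\<^sub>m n" "J * N = 1\<^sub>m n"
  using det_non_zero_imp_unit[OF assms, of "()"] unfolding Units_def ring_mat_def by auto

text \<open>
  If \<open>N\<close> is invertible, take \<open>y = N\<^sup>-\<^sup>1 M x\<close>, or any nonzero vector when this is zero; otherwise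
  take \<open>y\<close> in the kernel of \<open>N\<close>.
\<close>

lemma step_related_forward:
  assumes M: "M \<in> carrier_mat n n" and N: "N \<in> carrier_mat n n"
    and x: "x \<in> carrier_vec n" "x \<noteq> 0\<^sub>v n"
  shows "\<exists>y. step_related n M N x y"
proof (cases "det N = 0")
  case True
  then obtain y where "y \<in> carrier_vec n" "y \<noteq> 0\<^sub>v n" "N *\<^sub>v y = 0\<^sub>v n"
    using det_0_iff_vec_prod_zero_field[OF N] by blast
  then show ?thesis using step_related_kernel[OF M N x] by blast
next
  case False
  then obtain J where J: "J \<in> carrier_mat n n" "N * J = 1\<^sub>m n" by (rule inverse_exists[OF N])
  show ?thesis
  proof (cases "M *\<^sub>v x = 0\<^sub>v n")
    case True
    then have "step_related n N M x x" using step_related_kernel[OF N M x x] by simp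
    then show ?thesis unfolding step_related_swap[of n N] by blast
  next
    case nz: False
    define y where "y = J *\<^sub>v (M *\<^sub>v x)"
    have y: "y \<in> carrier_vec n" unfolding y_def using J M x by simp
    have Ny: "N *\<^sub>v y = M *\<^sub>v x"
      unfolding y_def using assoc_mult_mat_vec[OF N J(1), of "M *\<^sub>v x", symmetric] J M x by simp
    have "N *\<^sub>v 0\<^sub>v n = 0\<^sub>v n" by (rule eq_vecI) (use N in auto)
    then have "y \<noteq> 0\<^sub>v n" using Ny nz by auto
    moreover have "M *\<^sub>v x = 1 \<cdot>\<^sub>v (M *\<^sub>v x)" "N *\<^sub>v y = 1 \<cdot>\<^sub>v (M *\<^sub>v x)" "M *\<^sub>v x \<in> carrier_vec n"
      using Ny M x by auto
    ultimately have "step_related n M N x y" unfolding step_related_def using nz x y by blast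
    then show ?thesis by blast
  qed
qed

text \<open>
  A kernel vector of \<open>N c\<close> satisfies the relation at \<open>c\<close> with every predecessor. Hence it can
  serve as the start of a chain that moves forward from \<open>c + 1\<close> once around the cycle, and the
  chain closes no matter where it ends.
\<close>

lemma related_cycle_from_kernel:
  fixes M N :: "nat \<Rightarrow> complex mat"
  assumes p: "0 < p"
    and M: "\<And>k. M k \<in> carrier_mat n n" "\<And>k. M (k + p) = M k"
    and N: "\<And>k. N k \<in> carrier_mat n n" "\<And>k. N (k + p) = N k"
    and sing: "det (N c) = 0"
  shows "\<exists>z. (\<forall>k. z (k + p) = z k) \<and> (\<forall>k. step_related n (M k) (N k) (z k) (z (Suc k)))"
proof -
  obtain w where w: "w \<in> carrier_vec n" "w \<noteq> 0\<^sub>v n" "N c *\<^sub>v w = 0\<^sub>v n"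
    using det_0_iff_vec_prod_zero_field[OF N(1)] sing by blast
  have "\<exists>v. v 0 = w \<and> (\<forall>i. step_related n (M (Suc c + i)) (N (Suc c + i)) (v i) (v (Suc i)))"
  proof -
    define v where "v = rec_nat w (\<lambda>i x. SOME y. step_related n (M (Suc c + i)) (N (Suc c + i)) x y)"
    have v0: "v 0 = w" and vS: "v (Suc i) = (SOME y. step_related n (M (Suc c + i)) (N (Suc c + i)) (v i) y)" for i
      unfolding v_def by simp_all
    have step: "step_related n (M (Suc c + i)) (N (Suc c + i)) (v i) (v (Suc i))"
      if "v i \<in> carrier_vec n" "v i \<noteq> 0\<^sub>v n" for i
      unfolding vS by (rule someI_ex) (rule step_related_forward[OF M(1) N(1) that])
    have "v i \<in> carrier_vec n \<and> v i \<noteq> 0\<^sub>v n" for i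
    proof (induction i)
      case 0
      then show ?case using v0 w by simp
    next
      case (Suc i)
      then show ?case using step[of i] unfolding step_related_def by blast
    qed
    then show ?thesis using v0 step by blast
  qed
  then obtain v where v0: "v 0 = w"
    and v: "\<And>i. step_related n (M (Suc c + i)) (N (Suc c + i)) (v i) (v (Suc i))" by blast
  have Mc: "M (Suc c + (p - 1)) = M c" "N (Suc c + (p - 1)) = N c"
    using M(2)[of c] N(2)[of c] p by simp_all
  have "v (p - 1) \<in> carrier_vec n" "v (p - 1) \<noteq> 0\<^sub>v n"
    using v[of "p - 1"] unfolding step_related_def by auto
  then have "step_related n (M (Suc c + (p - 1))) (N (Suc c + (p - 1))) (v (p - 1)) (v 0)"
    unfolding Mc v0 using step_related_kernel[OF M(1) N(1)] w by blast
  then obtain z where "\<And>k. z (k + p) = z k" "\<And>k. step_related n (M k) (N k) (z k) (z (Suc k))"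
    using close_cycle[of p "\<lambda>k. step_related n (M k) (N k)" "Suc c" v] p v M(2) N(2) by metis
  then show ?thesis by blast
qed

text \<open>
  If all matrices are invertible, the formal product is an honest invertible matrix, and the
  orbit of one of its eigenvectors is the required cycle.
\<close>

lemma related_cycle_regular:
  fixes M N :: "nat \<Rightarrow> complex mat"
  assumes n: "0 < n" and p: "0 < p"
    and M: "\<And>k. M k \<in> carrier_mat n n" "\<And>k. M (k + p) = M k" "\<And>k. det (M k) \<noteq> 0"
    and N: "\<And>k. N k \<in> carrier_mat n n" "\<And>k. N (k + p) = N k" "\<And>k. det (N k) \<noteq> 0"
  shows "\<exists>z. (\<forall>k. z (k + p) = z k) \<and> (\<forall>k. step_related n (M k) (N k) (z k) (z (Suc k)))"
proof -
  have "\<exists>J. J \<in> carrier_mat n n \<and> N k * J = 1\<^sub>m n \<and> J * N k = 1\<^sub>m n" for k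
    using inverse_exists[OF N(1) N(3), of k] by blast
  then have "\<exists>J. \<forall>k. J k \<in> carrier_mat n n \<and> N k * J k = 1\<^sub>m n \<and> J k * N k = 1\<^sub>m n"
    by (intro choice allI)
  then obtain J where J: "\<And>k. J k \<in> carrier_mat n n" "\<And>k. N k * J k = 1\<^sub>m n" "\<And>k. J k * N k = 1\<^sub>m n"
    by blast
  define W where "W = rec_nat (1\<^sub>m n) (\<lambda>k V. J k * (M k * V))"
  have W0: "W 0 = 1\<^sub>m n" and WS: "W (Suc k) = J k * (M k * W k)" for k unfolding W_def by simp_all
  have W: "W k \<in> carrier_mat n n" for k
    by (induction k) (auto simp: W0 WS intro!: mult_carrier_mat[OF J(1)] mult_carrier_mat[OF M(1)])
  have dJ: "det (J k) \<noteq> 0" for k using det_mult[OF N(1)[of k] J(1)[of k]] J(2)[of k] by auto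
  have dW: "det (W k) \<noteq> 0" for k
    by (induction k) (auto simp: W0 WS det_mult[OF J(1) mult_carrier_mat[OF M(1) W]] det_mult[OF M(1) W] dJ M(3))
  obtain e where "eigenvalue (W p) e" using spectrum_non_empty[OF W n] unfolding spectrum_def by blast
  then obtain x where x: "x \<in> carrier_vec n" "x \<noteq> 0\<^sub>v n" "W p *\<^sub>v x = e \<cdot>\<^sub>v x"
    unfolding eigenvalue_def eigenvector_def using W[of p] by auto
  define v where "v k = W k *\<^sub>v x" for k
  have v: "v k \<in> carrier_vec n" for k unfolding v_def using W[of k] x by simp
  have vn: "v k \<noteq> 0\<^sub>v n" for k
    using det_0_iff_vec_prod_zero_field[OF W[of k]] dW x unfolding v_def by blast
  have v0: "v 0 = x" unfolding v_def W0 using x by simp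
  have vp: "v p = e \<cdot>\<^sub>v x" unfolding v_def using x by simp
  have e: "e \<noteq> 0" using vp vn[of p] x by auto
  have NvS: "N k *\<^sub>v v (Suc k) = M k *\<^sub>v v k" for k
  proof -
    have "N k *\<^sub>v v (Suc k) = (N k * W (Suc k)) *\<^sub>v x"
      unfolding v_def using assoc_mult_mat_vec[OF N(1) W x(1)] by simp
    also have "N k * W (Suc k) = M k * W k"
      unfolding WS using assoc_mult_mat[OF N(1) J(1) mult_carrier_mat[OF M(1) W], of k k k k, symmetric]
        J(2)[of k] left_mult_one_mat[OF mult_carrier_mat[OF M(1) W], of k k] by simp
    also have "\<dots> *\<^sub>v x = M k *\<^sub>v v k" unfolding v_def by (rule assoc_mult_mat_vec[OF M(1) W x(1)])
    finally show ?thesis .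
  qed
  have Mv: "M k *\<^sub>v v k \<in> carrier_vec n" "M k *\<^sub>v v k \<noteq> 0\<^sub>v n" for k
    using M(1)[of k] v[of k] det_0_iff_vec_prod_zero_field[OF M(1)[of k]] M(3)[of k] vn[of k] by auto
  have rel: "step_related n (M k) (N k) (v k) y" if "y \<in> carrier_vec n" "y \<noteq> 0\<^sub>v n" "v (Suc k) = a \<cdot>\<^sub>v y" "a \<noteq> 0" for k y a
  proof -
    have "N k *\<^sub>v (a \<cdot>\<^sub>v y) = M k *\<^sub>v v k" using NvS[of k] that by simp
    then have "a \<cdot>\<^sub>v (N k *\<^sub>v y) = M k *\<^sub>v v k" using that N(1)[of k] by (simp add: mult_mat_vec[OF N(1)])
    then have "N k *\<^sub>v y = inverse a \<cdot>\<^sub>v (M k *\<^sub>v v k)"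
      using that by (metis left_inverse one_smult_vec smult_smult_assoc)
    moreover have "M k *\<^sub>v v k = 1 \<cdot>\<^sub>v (M k *\<^sub>v v k)" by simp
    ultimately show ?thesis unfolding step_related_def using that v vn Mv by blast
  qed
  have "step_related n (M (0 + i)) (N (0 + i)) (v i) (v (Suc i))" for i
    using rel[OF v vn, of i 1] by simp
  moreover have "step_related n (M (0 + (p - 1))) (N (0 + (p - 1))) (v (p - 1)) (v 0)"
    unfolding v0 using rel[OF x(1,2), of "p - 1" e] vp e p by simp
  ultimately obtain z where "\<And>k. z (k + p) = z k" "\<And>k. step_related n (M k) (N k) (z k) (z (Suc k))"
    using close_cycle[of p "\<lambda>k. step_related n (M k) (N k)" 0 v] p M(2) N(2) by metis
  then show ?thesis by blast
qed

lemma related_cycle_exists: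
  fixes M N :: "nat \<Rightarrow> complex mat"
  assumes n: "0 < n" and p: "0 < p"
    and M: "\<And>k. M k \<in> carrier_mat n n" "\<And>k. M (k + p) = M k"
    and N: "\<And>k. N k \<in> carrier_mat n n" "\<And>k. N (k + p) = N k"
  shows "\<exists>z. (\<forall>k. z (k + p) = z k) \<and> (\<forall>k. step_related n (M k) (N k) (z k) (z (Suc k)))"
proof -
  consider c where "det (N c) = 0" | c where "det (M c) = 0"
    | "\<And>k. det (M k) \<noteq> 0" "\<And>k. det (N k) \<noteq> 0" by blast
  then show ?thesis
  proof cases
    case 1
    then show ?thesis using related_cycle_from_kernel[of p M n N c] p M N by blast
  next
    case 2
    \<comment> \<open>Run through the cycle backwards: index \<open>k\<close> becomes \<open>- k\<close> modulo \<open>p\<close>, written \<open>k * (p - 1)\<close>.\<close>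
    define f where "f k = k * (p - 1)" for k
    have fp: "f (k + p) = f k + (p - 1) * p" for k 
      unfolding f_def by (simp only: add_mult_distrib mult.commute[of p])
    have MN: "M (f (f k)) = M k" "N (f (f k)) = N k" for k
      unfolding f_def using periodic_reverse_twice[of p M] periodic_reverse_twice[of p N] p M N by auto
    define c' where "c' = f c"
    let ?M = "\<lambda>k. N (f k)" and ?N = "\<lambda>k. M (f k)"
    have "?M (k + p) = ?M k" "?N (k + p) = ?N k" for k
      unfolding fp using periodic_add_mult[of N p] periodic_add_mult[of M p] M N by auto
    moreover have "det (?N c') = 0" unfolding c'_def MN using 2 .
    ultimately obtain z where z: "\<And>k. z (k + p) = z k"
      "\<And>k. step_related n (?M k) (?N k) (z k) (z (Suc k))"
      using related_cycle_from_kernel[of p ?M n ?N c'] p M N by blast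
    define y where "y k = z (Suc (f k))" for k
    have "y (k + p) = y k" for k
      unfolding y_def fp using periodic_add_mult[of z p "Suc (f k)" "p - 1"] z(1) by simp
    moreover have "step_related n (M k) (N k) (y k) (y (Suc k))" for k
    proof -
      have "Suc (f (Suc k)) = f k + p" unfolding f_def using p by (cases p) auto
      then have "y (Suc k) = z (f k)" unfolding y_def using z(1) by simp
      then show ?thesis using z(2)[of "f k"] MN unfolding y_def step_related_swap[of n "M k"] by simp
    qed
    ultimately show ?thesis by blast
  next
    case 3
    then show ?thesis using related_cycle_regular[of n p M N] n p M N by blast
  qed
qed

text \<open>
  In coordinates whose first basis vectors are \<open>z\<close> and \<open>q\<close>, a matrix that maps \<open>z\<close> into the line
  of \<open>q\<close> has a first column that is zero below its first entry.
\<close>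

lemma first_column_zero:
  assumes M: "M \<in> carrier_mat n n" and Q: "unitary_mat n Q" and Z: "unitary_mat n Z"
    and z: "z \<noteq> 0\<^sub>v n" "z = c \<cdot>\<^sub>v col Z 0" and q: "q = d \<cdot>\<^sub>v col Q 0" and Mz: "M *\<^sub>v z = t \<cdot>\<^sub>v q"
    and i: "0 < i" "i < n"
  shows "(mat_adjoint Q * M * Z) $$ (i, 0) = 0"
proof -
  have n0: "0 < n" using i by simp
  have cz: "col Z 0 \<in> carrier_vec n" and cq: "col Q 0 \<in> carrier_vec n"
    by (rule col_carrier_vec[OF n0 unitary_carrier[OF Z]], rule col_carrier_vec[OF n0 unitary_carrier[OF Q]])
  have c: "c \<noteq> 0"
  proof
    assume "c = 0"
    then have "z = 0 \<cdot>\<^sub>v col Z 0" using z(2) by simp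
    also have "\<dots> = 0\<^sub>v n" 
      by (rule eq_vecI) (use n0 carrier_matD[OF unitary_carrier[OF Z]] in auto)
    finally have "z = 0\<^sub>v n" .
    then show False using z(1) by simp
  qed
  have "c \<cdot>\<^sub>v (M *\<^sub>v col Z 0) = (t * d) \<cdot>\<^sub>v col Q 0"
    using Mz unfolding z(2) q mult_mat_vec[OF M cz] by (simp add: smult_smult_assoc)
  then have "inverse c \<cdot>\<^sub>v (c \<cdot>\<^sub>v (M *\<^sub>v col Z 0)) = inverse c \<cdot>\<^sub>v ((t * d) \<cdot>\<^sub>v col Q 0)" by simp
  then have MZ: "M *\<^sub>v col Z 0 = (inverse c * (t * d)) \<cdot>\<^sub>v col Q 0"
    using c by (simp add: smult_smult_assoc)
  have "mat_adjoint Q * M * Z = mat_adjoint Q * (M * Z)"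
    by (rule assoc_mult_mat[OF adjoint_carrier[OF unitary_carrier[OF Q]] M unitary_carrier[OF Z]])
  then have "(mat_adjoint Q * M * Z) $$ (i, 0) = row (mat_adjoint Q) i \<bullet> col (M * Z) 0"
    using i M by (simp add: carrier_matD[OF unitary_carrier[OF Q]] carrier_matD[OF unitary_carrier[OF Z]])
  also have "col (M * Z) 0 = M *\<^sub>v col Z 0" 
    by (rule col_mult2[OF M unitary_carrier[OF Z] n0])
  also have "row (mat_adjoint Q) i \<bullet> \<dots> = (inverse c * (t * d)) * (row (mat_adjoint Q) i \<bullet> col Q 0)"
    unfolding MZ using row_carrier_vec[OF i(2) adjoint_carrier[OF unitary_carrier[OF Q]]] cq
    by (rule scalar_prod_smult_distrib)
  also have "row (mat_adjoint Q) i \<bullet> col Q 0 = (mat_adjoint Q * Q) $$ (i, 0)"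
    using i carrier_matD[OF unitary_carrier[OF Q]] by simp
  also have "\<dots> = 0" using i unitary_left[OF Q] by simp
  finally show ?thesis by simp
qed

lemma deflate_block:
  fixes S :: "complex mat"
  assumes S: "S \<in> carrier_mat (Suc n) (Suc n)" and col0: "\<And>i. 0 < i \<Longrightarrow> i < Suc n \<Longrightarrow> S $$ (i, 0) = 0"
  obtains a where "a \<in> carrier_mat 1 n"
    "S = four_block_mat (mat 1 1 (\<lambda>_. S $$ (0,0))) a (0\<^sub>m n 1) (mat n n (\<lambda>(i, j). S $$ (Suc i, Suc j)))"
proof -
  have "S = four_block_mat (mat 1 1 (\<lambda>_. S $$ (0,0))) (mat 1 n (\<lambda>(i,j). S $$ (0, Suc j))) (0\<^sub>m n 1)
    (mat n n (\<lambda>(i, j). S $$ (Suc i, Suc j)))"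
    by (rule eq_matI) (use S col0 in \<open>auto simp: not_less_eq less_Suc_eq_0_disj\<close>)
  moreover have "mat 1 n (\<lambda>(i,j). S $$ (0, Suc j)) \<in> carrier_mat 1 n" by simp
  ultimately show thesis using that by blast
qed

text \<open>
  Once the first column of \<open>S\<close> is zero below its first entry, a triangularisation of the lower right
  block, bordered by \<open>1\<close>, triangularises \<open>S\<close>.
\<close>

lemma deflation_step:
  fixes S :: "complex mat"
  assumes S: "S \<in> carrier_mat (Suc n) (Suc n)" and col0: "\<And>i. 0 < i \<Longrightarrow> i < Suc n \<Longrightarrow> S $$ (i, 0) = 0"
    and Q: "Q \<in> carrier_mat n n" and Z: "Z \<in> carrier_mat n n"
    and ut: "upper_triangular (mat_adjoint Q * mat n n (\<lambda>(i, j). S $$ (Suc i, Suc j)) * Z)"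
  shows "upper_triangular (mat_adjoint (four_block_mat (1\<^sub>m 1) (0\<^sub>m 1 n) (0\<^sub>m n 1) Q) * S *
    four_block_mat (1\<^sub>m 1) (0\<^sub>m 1 n) (0\<^sub>m n 1) Z)"
proof -
  let ?S = "mat n n (\<lambda>(i, j). S $$ (Suc i, Suc j))"
  let ?s = "mat 1 1 (\<lambda>_. S $$ (0,0))"
  let ?O = "1\<^sub>m 1 :: complex mat" and ?r = "0\<^sub>m 1 n :: complex mat" and ?c = "0\<^sub>m n 1 :: complex mat"
  obtain a where a: "a \<in> carrier_mat 1 n" and Sb: "S = four_block_mat ?s a ?c ?S"
    using deflate_block[OF S col0] by blast
  have adj: "mat_adjoint ?O = ?O" "mat_adjoint ?r = ?c" "mat_adjoint ?c = ?r"
    by (rule eq_matI; simp)+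
  have "mat_adjoint (four_block_mat ?O ?r ?c Q) = four_block_mat ?O ?r ?c (mat_adjoint Q)"
    using adjoint_four_block[of ?O 1 1 ?r n ?c n Q] Q unfolding adj by simp
  also have "four_block_mat ?O ?r ?c (mat_adjoint Q) * S = four_block_mat ?s a ?c (mat_adjoint Q * ?S)"
  proof -
    have QS: "mat_adjoint Q * ?S \<in> carrier_mat n n" using Q by (auto intro!: mult_carrier_mat[of _ n n])
    have "four_block_mat ?O ?r ?c (mat_adjoint Q) * four_block_mat ?s a ?c ?S =
      four_block_mat (?O * ?s + ?r * ?c) (?O * a + ?r * ?S)
        (?c * ?s + mat_adjoint Q * ?c) (?c * a + mat_adjoint Q * ?S)"
      by (rule mult_four_block_mat) (use a Q in auto)
    also have "?O * ?s + ?r * ?c = ?s" by (rule eq_matI) auto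
    also have "?O * a + ?r * ?S = a" by (rule eq_matI) (use a in auto)
    also have "?c * ?s + mat_adjoint Q * ?c = ?c" by (rule eq_matI) (use Q in auto)
    also have "?c * a + mat_adjoint Q * ?S = mat_adjoint Q * ?S"
      using a QS left_mult_zero_mat[OF a, of n] by simp
    finally show ?thesis unfolding Sb[symmetric] .
  qed
  also have "four_block_mat ?s a ?c (mat_adjoint Q * ?S) * four_block_mat ?O ?r ?c Z =
    four_block_mat ?s (a * Z) ?c (mat_adjoint Q * ?S * Z)"
  proof -
    have QS: "mat_adjoint Q * ?S \<in> carrier_mat n n" using Q by (auto intro!: mult_carrier_mat[of _ n n])
    have "four_block_mat ?s a ?c (mat_adjoint Q * ?S) * four_block_mat ?O ?r ?c Z =
      four_block_mat (?s * ?O + a * ?c) (?s * ?r + a * Z)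
        (?c * ?O + mat_adjoint Q * ?S * ?c) (?c * ?r + mat_adjoint Q * ?S * Z)"
      by (rule mult_four_block_mat[OF _ a _ QS]) (use Z in auto)
    also have "?s * ?O + a * ?c = ?s" by (rule eq_matI) (use a in auto)
    also have "?s * ?r + a * Z = a * Z"
      using mult_carrier_mat[OF a Z] right_mult_zero_mat[of ?s 1 1 n] by simp
    also have "?c * ?O + mat_adjoint Q * ?S * ?c = ?c"
      using right_mult_zero_mat[OF QS, of 1] by simp
    also have "?c * ?r + mat_adjoint Q * ?S * Z = mat_adjoint Q * ?S * Z"
      using left_mult_zero_mat[of ?r 1 n n] mult_carrier_mat[OF QS Z] by simp
    finally show ?thesis .
  qed
  finally have eq: "mat_adjoint (four_block_mat ?O ?r ?c Q) * S * four_block_mat ?O ?r ?c Z =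
    four_block_mat ?s (a * Z) ?c (mat_adjoint Q * ?S * Z)" .
  have "mat_adjoint Q * ?S * Z \<in> carrier_mat n n"
    using Q Z by (auto intro!: mult_carrier_mat[of _ n n])
  then show ?thesis
    unfolding eq by (intro upper_triangular_four_block[OF _ _ _ ut]) auto
qed

lemma unitary_one: "unitary_mat n (1\<^sub>m n)"
proof -
  have "mat_adjoint (1\<^sub>m n) = (1\<^sub>m n :: complex mat)" by (rule eq_matI) auto
  then show ?thesis unfolding unitary_mat_def by simp
qed

text \<open>
  Induction on \<open>n\<close>: a periodic deflating line supplies the first columns of all the unitary matrices
  at once, and the induction hypothesis is applied to the remaining blocks. The unitary matrices
  themselves have to be periodic, which is why the completions are chosen for the indices below
  \<open>p\<close> only and then repeated.
\<close>

lemma periodic_schur_exists: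
  fixes M N :: "nat \<Rightarrow> complex mat"
  assumes p: "0 < p"
    and "\<And>k. M k \<in> carrier_mat n n" "\<And>k. M (k + p) = M k"
    and "\<And>k. N k \<in> carrier_mat n n" "\<And>k. N (k + p) = N k"
  shows "\<exists>Q Z. (\<forall>k. unitary_mat n (Q k) \<and> unitary_mat n (Z k) \<and> Q (k + p) = Q k \<and> Z (k + p) = Z k \<and>
    upper_triangular (mat_adjoint (Q k) * M k * Z k) \<and>
    upper_triangular (mat_adjoint (Q k) * N k * Z (Suc k)))"
  using assms(2-)
proof (induction n arbitrary: M N)
  case 0
  have "unitary_mat 0 (1\<^sub>m 0)" by (rule unitary_one)
  moreover have "mat_adjoint (1\<^sub>m 0) * F * 1\<^sub>m 0 \<in> carrier_mat 0 0" for F :: "complex mat"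
    by (rule carrier_matI) simp_all
  then have "upper_triangular (mat_adjoint (1\<^sub>m 0) * F * 1\<^sub>m 0)" for F :: "complex mat"
    by (auto simp: upper_triangular_def)
  ultimately show ?case by (intro exI[of _ "\<lambda>_. 1\<^sub>m 0"]) blast
next
  case (Suc n)
  note M = Suc.prems(1,2) and N = Suc.prems(3,4)
  obtain z where zp: "\<And>k. z (k + p) = z k"
    and z: "\<And>k. step_related (Suc n) (M k) (N k) (z k) (z (Suc k))"
    using related_cycle_exists[of "Suc n" p M N] p M N by blast
  have zc: "z k \<in> carrier_vec (Suc n)" "z k \<noteq> 0\<^sub>v (Suc n)" for k
    using z[of k] unfolding step_related_def by auto
  have "\<exists>q t u. q \<in> carrier_vec (Suc n) \<and> q \<noteq> 0\<^sub>v (Suc n) \<and> M k *\<^sub>v z k = t \<cdot>\<^sub>v q \<and> N k *\<^sub>v z (Suc k) = u \<cdot>\<^sub>v q" for k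
    using z[of k] unfolding step_related_def by blast
  then obtain q t u where q: "\<And>k. q k \<in> carrier_vec (Suc n)" "\<And>k. q k \<noteq> 0\<^sub>v (Suc n)"
    "\<And>k. M k *\<^sub>v z k = t k \<cdot>\<^sub>v q k" "\<And>k. N k *\<^sub>v z (Suc k) = u k \<cdot>\<^sub>v q k" by metis
  have "\<exists>U c. unitary_mat (Suc n) U \<and> z k = c \<cdot>\<^sub>v col U 0" for k
    using unitary_with_first_column[OF zc] by metis
  then obtain Z1' cz where Z1': "\<And>k. unitary_mat (Suc n) (Z1' k)" "\<And>k. z k = cz k \<cdot>\<^sub>v col (Z1' k) 0" by metis
  have "\<exists>U c. unitary_mat (Suc n) U \<and> q k = c \<cdot>\<^sub>v col U 0" for k
    using unitary_with_first_column[OF q(1,2)] by metis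
  then obtain Q1' cq where Q1': "\<And>k. unitary_mat (Suc n) (Q1' k)" "\<And>k. q k = cq k \<cdot>\<^sub>v col (Q1' k) 0" by metis
  define Z1 Q1 where "Z1 k = Z1' (k mod p)" and "Q1 k = Q1' (k mod p)" for k
  have per1: "Z1 (k + p) = Z1 k" "Q1 (k + p) = Q1 k" for k unfolding Z1_def Q1_def by simp_all
  have u1: "unitary_mat (Suc n) (Z1 k)" "unitary_mat (Suc n) (Q1 k)" for k
    unfolding Z1_def Q1_def using Z1'(1) Q1'(1) by auto
  have zZ: "z k = cz (k mod p) \<cdot>\<^sub>v col (Z1 k) 0" for k
    unfolding Z1_def Z1'(2)[symmetric] using periodic_mod[of z p k, OF zp] by simp
  define SM SN where "SM k = mat_adjoint (Q1 k) * M k * Z1 k" and "SN k = mat_adjoint (Q1 k) * N k * Z1 (Suc k)" for k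
  have SMc: "SM k \<in> carrier_mat (Suc n) (Suc n)" and SNc: "SN k \<in> carrier_mat (Suc n) (Suc n)" for k
    unfolding SM_def SN_def using u1[of k] u1[of "Suc k"] M(1)[of k] N(1)[of k]
    by (auto intro!: mult_carrier_mat[of _ "Suc n" "Suc n"])
  have qQ: "q (k mod p) = cq (k mod p) \<cdot>\<^sub>v col (Q1 k) 0" for k
    unfolding Q1_def Q1'(2)[symmetric] by simp
  have Mz: "M k *\<^sub>v z k = t (k mod p) \<cdot>\<^sub>v q (k mod p)" for k
    using q(3)[of "k mod p"] periodic_mod[of z p k, OF zp] periodic_mod[of M p k, OF M(2)] by simp
  have Nz: "N k *\<^sub>v z (Suc k) = u (k mod p) \<cdot>\<^sub>v q (k mod p)" for k
  proof -
    have "z (Suc (k mod p)) = z (Suc k)"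
      using periodic_mod[of "\<lambda>k. z (Suc k)" p k] zp[of "Suc k" for k] by simp
    then show ?thesis using q(4)[of "k mod p"] periodic_mod[of N p k, OF N(2)] by simp
  qed
  have SM0: "SM k $$ (i, 0) = 0" if "0 < i" "i < Suc n" for i k
    unfolding SM_def by (rule first_column_zero[OF M(1) u1(2,1) zc(2) zZ qQ Mz that])
  have SN0: "SN k $$ (i, 0) = 0" if "0 < i" "i < Suc n" for i k
    unfolding SN_def by (rule first_column_zero[OF N(1) u1(2,1) zc(2) zZ qQ Nz that])
  define M' N' where "M' k = mat n n (\<lambda>(i, j). SM k $$ (Suc i, Suc j))"
    and "N' k = mat n n (\<lambda>(i, j). SN k $$ (Suc i, Suc j))" for k
  have perS: "SM (k + p) = SM k" "SN (k + p) = SN k" for k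
    unfolding SM_def SN_def using M(2) N(2) per1 per1(1)[of "Suc k"] by simp_all
  have "M' (k + p) = M' k" "N' (k + p) = N' k" "M' k \<in> carrier_mat n n" "N' k \<in> carrier_mat n n" for k
    unfolding M'_def N'_def perS by simp_all
  then obtain Q2 Z2 where u2: "\<And>k. unitary_mat n (Q2 k)" "\<And>k. unitary_mat n (Z2 k)"
    and per2: "\<And>k. Q2 (k + p) = Q2 k" "\<And>k. Z2 (k + p) = Z2 k"
    and ut: "\<And>k. upper_triangular (mat_adjoint (Q2 k) * M' k * Z2 k)"
      "\<And>k. upper_triangular (mat_adjoint (Q2 k) * N' k * Z2 (Suc k))"
    using Suc.IH[of M' N'] by blast
  define blk where "blk U = four_block_mat (1\<^sub>m 1) (0\<^sub>m 1 n) (0\<^sub>m n 1) U" for U :: "complex mat"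
  have ub: "unitary_mat (Suc n) (blk U)" if "unitary_mat n U" for U
    unfolding blk_def by (rule unitary_block[OF that])
  define Q Z where "Q k = Q1 k * blk (Q2 k)" and "Z k = Z1 k * blk (Z2 k)" for k
  have shift: "mat_adjoint (A * B) * F * (G * H) = mat_adjoint B * (mat_adjoint A * F * G) * H"
    if "unitary_mat (Suc n) A" "unitary_mat (Suc n) B" "F \<in> carrier_mat (Suc n) (Suc n)"
      "unitary_mat (Suc n) G" "unitary_mat (Suc n) H" for A B F G H
  proof -
    let ?c = "carrier_mat (Suc n) (Suc n)"
    have c: "mat_adjoint A \<in> ?c" "mat_adjoint B \<in> ?c" "G \<in> ?c" "H \<in> ?c"
      using that by (auto intro: unitary_carrier)
    have "mat_adjoint (A * B) = mat_adjoint B * mat_adjoint A"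
      using that by (intro adjoint_mult) (auto intro: unitary_carrier)
    then have "mat_adjoint (A * B) * F * (G * H) = mat_adjoint B * mat_adjoint A * F * (G * H)" by simp
    also have "mat_adjoint B * mat_adjoint A * F = mat_adjoint B * (mat_adjoint A * F)"
      by (rule assoc_mult_mat[OF c(2,1) that(3)])
    also have "mat_adjoint B * (mat_adjoint A * F) * (G * H) = mat_adjoint B * (mat_adjoint A * F) * G * H"
      by (rule assoc_mult_mat[OF mult_carrier_mat[OF c(2) mult_carrier_mat[OF c(1) that(3)]] c(3,4), symmetric])
    also have "mat_adjoint B * (mat_adjoint A * F) * G = mat_adjoint B * (mat_adjoint A * F * G)"
      by (rule assoc_mult_mat[OF c(2) mult_carrier_mat[OF c(1) that(3)] c(3)])
    finally show ?thesis .
  qed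
  have "unitary_mat (Suc n) (Q k)" "unitary_mat (Suc n) (Z k)" for k
    unfolding Q_def Z_def using unitary_mult u1 ub u2 by blast+
  moreover have "Q (k + p) = Q k" "Z (k + p) = Z k" for k
    unfolding Q_def Z_def per1 per2 by simp_all
  moreover have "upper_triangular (mat_adjoint (Q k) * M k * Z k)" for k
  proof -
    have "mat_adjoint (Q k) * M k * Z k = mat_adjoint (blk (Q2 k)) * SM k * blk (Z2 k)"
      unfolding Q_def Z_def SM_def by (rule shift[OF u1(2) ub[OF u2(1)] M(1) u1(1) ub[OF u2(2)]])
    then show ?thesis unfolding blk_def
      using deflation_step[OF SMc SM0 unitary_carrier[OF u2(1)] unitary_carrier[OF u2(2)]] ut(1)
      unfolding M'_def by simp
  qed
  moreover have "upper_triangular (mat_adjoint (Q k) * N k * Z (Suc k))" for k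
  proof -
    have "mat_adjoint (Q k) * N k * Z (Suc k) = mat_adjoint (blk (Q2 k)) * SN k * blk (Z2 (Suc k))"
      unfolding Q_def Z_def SN_def by (rule shift[OF u1(2) ub[OF u2(1)] N(1) u1(1) ub[OF u2(2)]])
    then show ?thesis unfolding blk_def
      using deflation_step[OF SNc SN0 unitary_carrier[OF u2(1)] unitary_carrier[OF u2(2)]] ut(2)
      unfolding N'_def by simp
  qed
  ultimately show ?case by (intro exI[of _ Q] exI[of _ Z]) blast
qed

lemma periodic_schur_decomposition:
  fixes M N :: "nat \<Rightarrow> complex mat"
  assumes p: "0 < p"
    and M: "\<And>k. k \<in> {1..p} \<Longrightarrow> M k \<in> carrier_mat n n" and N: "\<And>k. k \<in> {1..p} \<Longrightarrow> N k \<in> carrier_mat n n"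
  shows "\<exists>Q Z T R. periodic_schur n p M N Q Z T R"
proof -
  have idx: "Suc (k mod p) \<in> {1..p}" for k using p by (simp add: Suc_le_eq)
  let ?M = "\<lambda>k. M (Suc (k mod p))" and ?N = "\<lambda>k. N (Suc (k mod p))"
  have "?M k \<in> carrier_mat n n" "?M (k + p) = ?M k" "?N k \<in> carrier_mat n n" "?N (k + p) = ?N k" for k
    using M[OF idx] N[OF idx] by simp_all
  then obtain Q Z where QZ: "\<And>k. unitary_mat n (Q k)" "\<And>k. unitary_mat n (Z k)"
    "\<And>k. Z (k + p) = Z k"
    "\<And>k. upper_triangular (mat_adjoint (Q k) * ?M k * Z k)"
    "\<And>k. upper_triangular (mat_adjoint (Q k) * ?N k * Z (Suc k))"
    using periodic_schur_exists[of p ?M n ?N] p by blast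
  have "periodic_schur n p M N (\<lambda>k. Q (k - 1)) (\<lambda>k. Z (k - 1))
    (\<lambda>k. mat_adjoint (Q (k - 1)) * M k * Z (k - 1)) (\<lambda>k. mat_adjoint (Q (k - 1)) * N k * Z k)"
    unfolding periodic_schur_def
  proof (intro conjI ballI)
    show "Z (p + 1 - 1) = Z (1 - 1)" using QZ(3)[of 0] by simp
    fix k assume k: "k \<in> {1..p}"
    then have "Suc ((k - 1) mod p) = k" "Suc (k - 1) = k" by auto
    then show "upper_triangular (mat_adjoint (Q (k - 1)) * M k * Z (k - 1))"
      "upper_triangular (mat_adjoint (Q (k - 1)) * N k * Z k)"
      using QZ(4,5)[of "k - 1"] by simp_all
  qed (use QZ in auto)
  then show ?thesis by blast
qed

section \<open>Cyclic scalar equations\<close>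

text \<open>
  Moving the window by one exchanges its first factor for an equal one at the end. Nothing has to
  be cancelled, so zero factors do no harm.
\<close>

lemma prod_period_window:
  fixes f :: "nat \<Rightarrow> 'a :: comm_monoid_mult"
  assumes per: "\<And>k. f (k + p) = f k"
  shows "(\<Prod>j<p. f (c + j)) = (\<Prod>j<p. f j)"
proof (cases p)
  case (Suc q)
  show ?thesis
  proof (induction c)
    case (Suc c)
    have "(\<Prod>j<p. f (Suc c + j)) = (\<Prod>j<q. f (Suc c + j)) * f (c + p)"
      unfolding \<open>p = Suc q\<close> by simp
    also have "\<dots> = f c * (\<Prod>j<q. f (c + Suc j))" by (simp add: per mult.commute)
    also have "\<dots> = (\<Prod>j<p. f (c + j))"
      unfolding \<open>p = Suc q\<close> prod.lessThan_Suc_shift by simp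
    finally show ?case using Suc by simp
  qed simp
qed simp

text \<open>
  Substituting the equations into each other once around the cycle leaves
  \<open>(\<Prod>a - \<Prod>b) * w m = g m\<close> with the explicit sum \<open>g\<close> below, so this determines \<open>w\<close>. Conversely, the
  sums \<open>a m * g m\<close> and \<open>b m * g (m + 1)\<close> have all but one of their terms in common.
\<close>

lemma cyclic_solution:
  fixes a b f :: "nat \<Rightarrow> 'a :: field"
  assumes per: "\<And>k. a (k + p) = a k" "\<And>k. b (k + p) = b k" "\<And>k. f (k + p) = f k"
    and ne: "(\<Prod>k<p. a k) \<noteq> (\<Prod>k<p. b k)"
  shows "\<exists>w. (\<forall>k. w (k + p) = w k) \<and> (\<forall>k. a k * w k - b k * w (Suc k) = f k)"
proof -
  define g where "g m = (\<Sum>j<p. (\<Prod>i<j. b (m + i)) * f (m + j) * (\<Prod>i=Suc j..<p. a (m + i)))" for m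
  define w where "w m = g m / ((\<Prod>k<p. a k) - (\<Prod>k<p. b k))" for m
  have key: "a m * g m - b m * g (Suc m) = f m * ((\<Prod>k<p. a k) - (\<Prod>k<p. b k))" for m
  proof -
    define h where "h j = (\<Prod>i<j. b (m + i)) * f (m + j) * (\<Prod>i=Suc j..<Suc p. a (m + i))" for j
    have "a m * g m = (\<Sum>j<p. h j)"
      unfolding g_def h_def sum_distrib_left
      by (rule sum.cong) (auto simp: per prod.atLeastLessThan_Suc)
    moreover have "b m * g (Suc m) = (\<Sum>j<p. h (Suc j))"
      unfolding g_def h_def sum_distrib_left
    proof (rule sum.cong)
      fix j
      have "(\<Prod>i=Suc (Suc j)..<Suc p. a (m + i)) = (\<Prod>i=Suc j..<p. a (Suc m + i))"
        by (simp only: prod.shift_bounds_Suc_ivl) simp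
      moreover have "(\<Prod>i<Suc j. b (m + i)) = b m * (\<Prod>i<j. b (Suc m + i))"
        by (simp only: prod.lessThan_Suc_shift) simp
      ultimately show "b m * ((\<Prod>i<j. b (Suc m + i)) * f (Suc m + j) * (\<Prod>i=Suc j..<p. a (Suc m + i))) =
        (\<Prod>i<Suc j. b (m + i)) * f (m + Suc j) * (\<Prod>i=Suc (Suc j)..<Suc p. a (m + i))"
        by (simp add: mult.assoc)
    qed simp
    ultimately have "a m * g m - b m * g (Suc m) = h 0 - h p"
      by (simp add: sum_lessThan_telescope' sum_subtractf[symmetric])
    also have "h 0 = f m * (\<Prod>k<p. a k)"
    proof -
      have "(\<Prod>i=Suc 0..<Suc p. a (m + i)) = (\<Prod>i<p. a (Suc m + i))"
        by (simp only: prod.shift_bounds_Suc_ivl) (simp add: atLeast0LessThan)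
      then show ?thesis unfolding h_def using prod_period_window[of a p "Suc m", OF per(1)] by simp
    qed
    also have "h p = f m * (\<Prod>k<p. b k)"
      unfolding h_def using prod_period_window[of b p m, OF per(2)] by (simp add: per)
    finally show ?thesis by (simp add: algebra_simps)
  qed
  have "g (m + p) = g m" for m
  proof -
    have "a (m + p + i) = a (m + i)" "b (m + p + i) = b (m + i)" "f (m + p + i) = f (m + i)" for i
      using per(1)[of "m + i"] per(2)[of "m + i"] per(3)[of "m + i"] by (simp_all add: ac_simps)
    then show ?thesis unfolding g_def by simp
  qed
  then have "w (k + p) = w k" for k unfolding w_def by simp
  moreover have "a k * w k - b k * w (Suc k) = f k" for k
    using key[of k] ne unfolding w_def by (simp add: diff_divide_distrib[symmetric])
  ultimately show ?thesis by blast
qed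

lemma cyclic_unique:
  fixes a b w :: "nat \<Rightarrow> 'a :: field"
  assumes per: "\<And>k. a (k + p) = a k" "\<And>k. b (k + p) = b k" "\<And>k. w (k + p) = w k"
    and ne: "(\<Prod>k<p. a k) \<noteq> (\<Prod>k<p. b k)"
    and eq: "\<And>k. a k * w k = b k * w (Suc k)"
  shows "w m = 0"
proof -
  have "(\<Prod>i<j. a (m + i)) * w m = (\<Prod>i<j. b (m + i)) * w (m + j)" for j
  proof (induction j)
    case (Suc j)
    have "(\<Prod>i<Suc j. a (m + i)) * w m = a (m + j) * ((\<Prod>i<j. a (m + i)) * w m)" by simp
    also have "\<dots> = (\<Prod>i<j. b (m + i)) * (a (m + j) * w (m + j))" unfolding Suc by simp
    also have "\<dots> = (\<Prod>i<Suc j. b (m + i)) * w (m + Suc j)" unfolding eq by simp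
    finally show ?case .
  qed simp
  from this[of p] have "((\<Prod>k<p. a k) - (\<Prod>k<p. b k)) * w m = 0"
    using prod_period_window[of a p m, OF per(1)] prod_period_window[of b p m, OF per(2)] per(3)[of m]
    by (simp add: algebra_simps)
  then show ?thesis using ne by simp
qed

text \<open>
  If the common product is nonzero, the equations can be solved successively and the solution
  closes up. If it is zero, some \<open>b c\<close> vanishes: cutting the cycle after \<open>c\<close> leaves an upper
  bidiagonal system with a zero on its diagonal \<open>a\<close>. The kernel vector is supported on the indices
  up to the first such zero and is found by back substitution.
\<close>

lemma cyclic_kernel:
  fixes a b :: "nat \<Rightarrow> 'a :: field"
  assumes p: "0 < p" and per: "\<And>k. a (k + p) = a k" "\<And>k. b (k + p) = b k"
    and eq: "(\<Prod>k<p. a k) = (\<Prod>k<p. b k)"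
  shows "\<exists>w. (\<forall>k. w (k + p) = w k) \<and> (\<exists>k. w k \<noteq> 0) \<and> (\<forall>k. a k * w k = b k * w (Suc k))"
proof (cases "(\<Prod>k<p. b k) = 0")
  case False
  then have b: "b k \<noteq> 0" if "k < p" for k using that by (metis finite_lessThan lessThan_iff prod_zero)
  have b: "b k \<noteq> 0" for k
    using b[of "k mod p"] periodic_mod[of b p k, OF per(2)] p by simp
  define w where "w k = (\<Prod>j<k. a j / b j)" for k
  have w: "a k * w k = b k * w (Suc k)" for k unfolding w_def using b[of k] by simp
  have "w p = 1" unfolding w_def prod_dividef using eq False by simp
  then have "w (k + p) = w k" for k
    unfolding w_def by (induction k) (simp_all add: per)
  moreover have "w 0 \<noteq> 0" unfolding w_def by simp
  ultimately show ?thesis using w by blast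
next
  case True
  obtain c where c: "c < p" "b c = 0" using True by (auto simp: prod_zero_iff)
  define a' b' where "a' i = a (Suc c + i)" and "b' i = b (Suc c + i)" for i
  have "(\<Prod>j<p. a' j) = 0"
    unfolding a'_def using prod_period_window[of a p "Suc c", OF per(1)] True eq by simp
  then have "\<exists>i. i < p \<and> a' i = 0" by (auto simp: prod_zero_iff)
  then obtain e where e: "e < p" "a' e = 0" and min: "\<And>i. i < e \<Longrightarrow> a' i \<noteq> 0"
    using exists_least_iff[of "\<lambda>i. i < p \<and> a' i = 0"] by (metis order.strict_trans)
  define v where "v k = (if k \<le> e then \<Prod>j=k..<e. b' j / a' j else 0)" for k
  have b'p: "b' (p - 1) = 0" unfolding b'_def using c per(2)[of c] p by simp
  have step: "a' i * v i = b' i * v (Suc i)" if "Suc i < p" for i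
  proof -
    consider "i < e" | "i = e" | "e < i" by linarith
    then show ?thesis
    proof cases
      case 1
      then have "v i = b' i / a' i * v (Suc i)"
        unfolding v_def by (simp add: prod.atLeast_Suc_lessThan)
      then show ?thesis using min[OF 1] by simp
    qed (use e in \<open>auto simp: v_def\<close>)
  qed
  have closing: "a' (p - 1) * v (p - 1) = b' (p - 1) * v 0"
    using e b'p unfolding v_def by (cases "p - 1 = e") auto
  have "v e \<noteq> 0" unfolding v_def by simp
  obtain z where z: "\<And>k. z (k + p) = z k" "\<And>k. a k * z k = b k * z (Suc k)"
    "\<And>i. i < p \<Longrightarrow> z (Suc c + i) = v i"
    using close_cycle[of p "\<lambda>k x y. a k * x = b k * y" "Suc c" v] p per step closing
    unfolding a'_def b'_def by (metis (no_types, lifting))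
  have "z (Suc c + e) \<noteq> 0" using z(3)[OF e(1)] \<open>v e \<noteq> 0\<close> by simp
  then show ?thesis using z by blast
qed

section \<open>Star-twisted triangular systems of scalar equations\<close>

fun star_scalar :: "star_op \<Rightarrow> complex \<Rightarrow> complex" where
  "star_scalar Transpose z = z"
| "star_scalar Adjoint z = cnj z"

lemma star_scalar_simps [simp]:
  "star_scalar s (star_scalar s z) = z"
  "star_scalar s (x + y) = star_scalar s x + star_scalar s y"
  "star_scalar s (x - y) = star_scalar s x - star_scalar s y"
  "star_scalar s (x * y) = star_scalar s x * star_scalar s y"
  "star_scalar s 0 = 0"
  "star_scalar s z = 0 \<longleftrightarrow> z = 0"
  by (cases s; simp)+

lemma star_scalar_sum: "star_scalar s (sum f I) = (\<Sum>i\<in>I. star_scalar s (f i))"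
  by (cases s) simp_all

lemma star_scalar_prod: "star_scalar s (prod f I) = (\<Prod>i\<in>I. star_scalar s (f i))"
  by (cases s) simp_all

text \<open>
  Entries \<open>y k i j\<close> of a sequence of matrices with \<open>Y (k + r) = Y k\<^sup>\<star>\<close>. Since the star is an
  involution, such a sequence has period \<open>2 * r\<close> and is determined by \<open>r\<close> consecutive matrices.
  In terms of such sequences the last unknown is not special: its successor \<open>X\<^sub>1\<^sup>\<star>\<close> is simply
  the next member, and all equations have the same form.
\<close>

definition twisted :: "star_op \<Rightarrow> nat \<Rightarrow> (nat \<Rightarrow> nat \<Rightarrow> nat \<Rightarrow> complex) \<Rightarrow> bool" where
  "twisted s r y \<longleftrightarrow> (\<forall>k i j. y (k + r) i j = star_scalar s (y k j i))"

lemma twistedD: "twisted s r y \<Longrightarrow> y (k + r) i j = star_scalar s (y k j i)"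
  unfolding twisted_def by blast

lemma twisted_periodic: "twisted s r y \<Longrightarrow> y (k + 2 * r) i j = y k i j"
  using twistedD[of s r y "k + r" i j] twistedD[of s r y k j i] by (simp add: mult_2 add.assoc)

lemma twisted_zero: "twisted s r (\<lambda>_ _ _. 0)"
  unfolding twisted_def by simp

text \<open>
  The functions \<open>t\<close> and \<open>u\<close> hold the entries of two \<open>2 * r\<close>-periodic sequences \<open>T\<close> and \<open>R\<close> of
  upper triangular matrices, and \<open>sylvester\<close> below gives the entries of
  \<open>T k * Y k * T (k + r)\<^sup>\<star> - R k * Y (k + 1) * R (k + r)\<^sup>\<star>\<close>. By triangularity the entry \<open>(i, j)\<close> of
  this matrix involves the entries of \<open>Y\<close> at \<open>(a, b)\<close> with \<open>a \<ge> i\<close> and \<open>b \<ge> j\<close> only. The system is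
  therefore block triangular with respect to the level \<open>i + j\<close>. The star exchanges \<open>(i, j)\<close> with
  \<open>(j, i)\<close>, which preserves the level.
\<close>

locale triangular_star_system =
  fixes s :: star_op and n r :: nat and t u :: "nat \<Rightarrow> nat \<Rightarrow> nat \<Rightarrow> complex"
  assumes r_pos: "0 < r"
    and t_per: "t (k + 2 * r) = t k" and u_per: "u (k + 2 * r) = u k"
    and t_upper: "j < i \<Longrightarrow> i < n \<Longrightarrow> t k i j = 0"
    and u_upper: "j < i \<Longrightarrow> i < n \<Longrightarrow> u k i j = 0"
begin

definition sylvester :: "(nat \<Rightarrow> nat \<Rightarrow> nat \<Rightarrow> complex) \<Rightarrow> nat \<Rightarrow> nat \<Rightarrow> nat \<Rightarrow> complex" where
  "sylvester y k i j = (\<Sum>a<n. \<Sum>b<n.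
     t k i a * y k a b * star_scalar s (t (k + r) j b) -
     u k i a * y (Suc k) a b * star_scalar s (u (k + r) j b))"

definition lead :: "nat \<Rightarrow> nat \<Rightarrow> nat \<Rightarrow> complex" where
  "lead k i j = t k i i * star_scalar s (t (k + r) j j)"

definition follow :: "nat \<Rightarrow> nat \<Rightarrow> nat \<Rightarrow> complex" where
  "follow k i j = u k i i * star_scalar s (u (k + r) j j)"

text \<open>
  The condition for the cyclic equation at \<open>(i, j)\<close> to be uniquely solvable. For the transpose and
  \<open>i = j\<close> the twist makes the unknown \<open>r\<close>-periodic, so that the cycle is half as long. This is
  where the exceptional role of the eigenvalue \<open>- 1\<close> comes from.
\<close>

definition nonresonant :: "nat \<Rightarrow> nat \<Rightarrow> bool" where
  "nonresonant i j \<longleftrightarrow>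
     (if s = Transpose \<and> i = j then (\<Prod>k<r. lead k i i) \<noteq> (\<Prod>k<r. follow k i i)
      else (\<Prod>k<2 * r. lead k i j) \<noteq> (\<Prod>k<2 * r. follow k i j))"

lemma nonresonant_diagonal:
  "s = Transpose \<Longrightarrow> nonresonant i i \<longleftrightarrow> (\<Prod>k<r. lead k i i) \<noteq> (\<Prod>k<r. follow k i i)"
  unfolding nonresonant_def by (subst if_P) blast+

lemma nonresonant_otherwise:
  "\<not> (s = Transpose \<and> i = j) \<Longrightarrow>
    nonresonant i j \<longleftrightarrow> (\<Prod>k<2 * r. lead k i j) \<noteq> (\<Prod>k<2 * r. follow k i j)"
  unfolding nonresonant_def by (subst if_not_P) blast+

lemma t_per': "t (k + r + r) = t k" and u_per': "u (k + r + r) = u k"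
  using t_per[of k] u_per[of k] by (simp_all add: mult_2 add.assoc)

lemma lead_per: "lead (k + 2 * r) i j = lead k i j" and follow_per: "follow (k + 2 * r) i j = follow k i j"
  unfolding lead_def follow_def using t_per[of k] t_per[of "k + r"] u_per[of k] u_per[of "k + r"]
  by (simp_all add: ac_simps)

lemma lead_twist: "lead (k + r) i j = star_scalar s (lead k j i)"
  and follow_twist: "follow (k + r) i j = star_scalar s (follow k j i)"
  unfolding lead_def follow_def t_per' u_per' by simp_all

lemma diagonal_per:
  assumes "s = Transpose"
  shows "lead (k + r) i i = lead k i i" "follow (k + r) i i = follow k i i"
proof -
  have "star_scalar s z = z" for z using assms by simp
  then show "lead (k + r) i i = lead k i i" "follow (k + r) i i = follow k i i"
    unfolding lead_twist follow_twist by blast+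
qed

text \<open>
  The equation at \<open>k + r\<close> is the star of the equation at \<open>k\<close>. Hence the equations at \<open>(j, i)\<close>
  follow from those at \<open>(i, j)\<close>.
\<close>

lemma twisted_sylvester:
  assumes y: "twisted s r y"
  shows "twisted s r (sylvester y)"
  unfolding twisted_def
proof (intro allI)
  fix k i j
  have "sylvester y (k + r) i j = (\<Sum>a<n. \<Sum>b<n.
     t (k + r) i a * star_scalar s (y k b a) * star_scalar s (t k j b) -
     u (k + r) i a * star_scalar s (y (Suc k) b a) * star_scalar s (u k j b))"
    unfolding sylvester_def t_per' u_per' twistedD[OF y] add_Suc[symmetric] ..
  also have "\<dots> = (\<Sum>b<n. \<Sum>a<n.
     t (k + r) i a * star_scalar s (y k b a) * star_scalar s (t k j b) -
     u (k + r) i a * star_scalar s (y (Suc k) b a) * star_scalar s (u k j b))"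
    by (rule sum.swap)
  also have "\<dots> = star_scalar s (sylvester y k j i)"
    unfolding sylvester_def star_scalar_sum by (simp add: ac_simps)
  finally show "sylvester y (k + r) i j = star_scalar s (sylvester y k j i)" .
qed

text \<open>
  Block triangularity: a change of \<open>y\<close> that avoids all \<open>(a, b) \<noteq> (i, j)\<close> with \<open>a \<ge> i\<close> and \<open>b \<ge> j\<close>
  enters the equation at \<open>(i, j)\<close> through the diagonal coefficients alone.
\<close>

lemma sylvester_diff:
  assumes i: "i < n" and j: "j < n"
    and agree: "\<And>k a b. i \<le> a \<Longrightarrow> j \<le> b \<Longrightarrow> a < n \<Longrightarrow> b < n \<Longrightarrow> (a, b) \<noteq> (i, j) \<Longrightarrow> y k a b = z k a b"
  shows "sylvester y k i j - sylvester z k i j =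
    lead k i j * (y k i j - z k i j) - follow k i j * (y (Suc k) i j - z (Suc k) i j)"
proof -
  let ?v = "lead k i j * (y k i j - z k i j) - follow k i j * (y (Suc k) i j - z (Suc k) i j)"
  have "sylvester y k i j - sylvester z k i j = (\<Sum>a<n. \<Sum>b<n.
     t k i a * (y k a b - z k a b) * star_scalar s (t (k + r) j b) -
     u k i a * (y (Suc k) a b - z (Suc k) a b) * star_scalar s (u (k + r) j b))"
    unfolding sylvester_def sum_subtractf[symmetric] by (simp add: algebra_simps)
  also have "\<dots> = (\<Sum>a<n. \<Sum>b<n. if a = i then (if b = j then ?v else 0) else 0)"
  proof (intro sum.cong refl)
    fix a b assume ab: "a \<in> {..<n}" "b \<in> {..<n}"
    consider "(a, b) = (i, j)" | "a < i" | "b < j" | "(a, b) \<noteq> (i, j)" "i \<le> a" "j \<le> b" by force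
    then show "t k i a * (y k a b - z k a b) * star_scalar s (t (k + r) j b) -
        u k i a * (y (Suc k) a b - z (Suc k) a b) * star_scalar s (u (k + r) j b) =
      (if a = i then (if b = j then ?v else 0) else 0)"
    proof cases
      case 1
      then show ?thesis by (simp add: lead_def follow_def)
    next
      case 2
      then show ?thesis using t_upper[of a i] u_upper[of a i] i by simp
    next
      case 3
      then show ?thesis using t_upper[of b j] u_upper[of b j] j by auto
    next
      case 4
      then show ?thesis using agree[of a b] ab by auto
    qed
  qed
  also have "\<dots> = (\<Sum>a<n. if a = i then ?v else 0)"
  proof (rule sum.cong[OF refl])
    fix a
    show "(\<Sum>b<n. if a = i then (if b = j then ?v else 0) else 0) = (if a = i then ?v else 0)"
      using j by (cases "a = i") simp_all
  qed
  also have "\<dots> = ?v" using i by (simp add: sum.delta)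
  finally show ?thesis .
qed

lemma block_unique:
  assumes nr: "nonresonant i j" and per: "\<And>k. w (k + 2 * r) = w k"
    and tw: "i = j \<Longrightarrow> (\<And>k. w (k + r) = star_scalar s (w k))"
    and eq: "\<And>k. lead k i j * w k = follow k i j * w (Suc k)"
  shows "w k = 0"
proof (cases "s = Transpose \<and> i = j")
  case True
  then have T: "s = Transpose" and ij: "j = i" by auto
  have "star_scalar s z = z" for z using T by simp
  then have wr: "w (k + r) = w k" for k using tw ij by simp
  show ?thesis
    by (rule cyclic_unique[of "\<lambda>k. lead k i i" r "\<lambda>k. follow k i i", OF diagonal_per[OF T] wr
          nonresonant_diagonal[OF T, THEN iffD1] eq[unfolded ij]])
      (use nr ij in blast)
next
  case False
  show ?thesis
    by (rule cyclic_unique[of "\<lambda>k. lead k i j" "2 * r" "\<lambda>k. follow k i j", OF lead_per follow_per per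
          nonresonant_otherwise[OF False, THEN iffD1, OF nr] eq])
qed

text \<open>
  In the case of the adjoint and \<open>i = j\<close>, the solution has to satisfy a semilinear symmetry.
  It holds automatically, since the twisted conjugate of a solution is again a solution of the
  same uniquely solvable equation.
\<close>

lemma block_solution:
  assumes nr: "nonresonant i j" and per: "\<And>k. f (k + 2 * r) = f k"
    and tw: "i = j \<Longrightarrow> (\<And>k. f (k + r) = star_scalar s (f k))"
  shows "\<exists>w. (\<forall>k. w (k + 2 * r) = w k) \<and> (i = j \<longrightarrow> (\<forall>k. w (k + r) = star_scalar s (w k))) \<and>
    (\<forall>k. lead k i j * w k - follow k i j * w (Suc k) = f k)"
proof (cases "s = Transpose \<and> i = j")
  case True
  then have T: "s = Transpose" and ij: "j = i" by auto
  have st: "star_scalar s z = z" for z using T by simp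
  have fr: "f (k + r) = f k" for k using tw ij st by simp
  obtain w where w: "\<And>k. w (k + r) = w k" "\<And>k. lead k i i * w k - follow k i i * w (Suc k) = f k"
    using cyclic_solution[of "\<lambda>k. lead k i i" r "\<lambda>k. follow k i i" f, OF diagonal_per[OF T] fr
      nonresonant_diagonal[OF T, THEN iffD1]] nr ij by blast
  moreover have "w (k + 2 * r) = w k" for k using w(1)[of "k + r"] w(1)[of k] by (simp add: mult_2 add.assoc)
  ultimately show ?thesis unfolding ij st by blast
next
  case False
  obtain w where w: "\<And>k. w (k + 2 * r) = w k" "\<And>k. lead k i j * w k - follow k i j * w (Suc k) = f k"
    using cyclic_solution[of "\<lambda>k. lead k i j" "2 * r" "\<lambda>k. follow k i j" f, OF lead_per follow_per per
      nonresonant_otherwise[OF False, THEN iffD1, OF nr]] by blast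
  moreover have "w (k + r) = star_scalar s (w k)" if "i = j" for k
  proof -
    define v where "v k = star_scalar s (w (k + r))" for k
    have vper: "v (k + 2 * r) = v k" for k
      unfolding v_def using w(1)[of "k + r"] by (simp add: ac_simps)
    have v: "lead k i j * v k - follow k i j * v (Suc k) = f k" for k
    proof -
      have "star_scalar s (lead (k + r) i j * w (k + r) - follow (k + r) i j * w (Suc (k + r))) =
        star_scalar s (f (k + r))" unfolding w(2) ..
      then show ?thesis using that tw[OF that] by (simp add: v_def lead_twist follow_twist)
    qed
    have "v k - w k = 0"
    proof (rule cyclic_unique[of "\<lambda>k. lead k i j" "2 * r" "\<lambda>k. follow k i j" "\<lambda>k. v k - w k", OF lead_per follow_per])
      show "(\<Prod>k<2 * r. lead k i j) \<noteq> (\<Prod>k<2 * r. follow k i j)"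
        using nonresonant_otherwise[OF False] nr by blast
      show "lead k i j * (v k - w k) = follow k i j * (v (Suc k) - w (Suc k))" for k
        using w(2)[of k] v[of k] by (simp add: algebra_simps)
    qed (use vper w(1) in simp)
    then have "star_scalar s (w (k + r)) = w k" unfolding v_def by simp
    then show ?thesis by (metis star_scalar_simps(1))
  qed
  ultimately show ?thesis by blast
qed

lemma block_kernel:
  assumes nr: "\<not> nonresonant i j"
  shows "\<exists>w. (\<forall>k. w (k + 2 * r) = w k) \<and> (i = j \<longrightarrow> (\<forall>k. w (k + r) = star_scalar s (w k))) \<and>
    (\<forall>k. lead k i j * w k = follow k i j * w (Suc k)) \<and> (\<exists>k. w k \<noteq> 0)"
proof (cases "s = Transpose \<and> i = j")
  case True
  then have T: "s = Transpose" and ij: "j = i" by auto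
  have st: "star_scalar s z = z" for z using T by simp
  have "(\<Prod>k<r. lead k i i) = (\<Prod>k<r. follow k i i)" using nr nonresonant_diagonal[OF T] ij by blast
  from cyclic_kernel[of r "\<lambda>k. lead k i i" "\<lambda>k. follow k i i", OF r_pos diagonal_per[OF T] this]
  obtain w where w: "\<And>k. w (k + r) = w k" "\<And>k. lead k i i * w k = follow k i i * w (Suc k)"
    "\<exists>k. w k \<noteq> 0" by blast
  moreover have "w (k + 2 * r) = w k" for k using w(1)[of "k + r"] w(1)[of k] by (simp add: mult_2 add.assoc)
  ultimately show ?thesis unfolding ij st by blast
next
  case False
  have r2: "0 < 2 * r" using r_pos by simp
  have "(\<Prod>k<2 * r. lead k i j) = (\<Prod>k<2 * r. follow k i j)" using nr nonresonant_otherwise[OF False] by blast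
  from cyclic_kernel[of "2 * r" "\<lambda>k. lead k i j" "\<lambda>k. follow k i j", OF r2 lead_per follow_per this]
  obtain w where w: "\<And>k. w (k + 2 * r) = w k" "\<And>k. lead k i j * w k = follow k i j * w (Suc k)"
    "\<exists>k. w k \<noteq> 0" by blast
  show ?thesis
  proof (cases "i = j")
    case False
    then show ?thesis using w by blast
  next
    case ij: True
    then have s: "s = Adjoint" using False by (cases s) auto
    have st: "star_scalar s z = cnj z" for z using s by simp
    have w2: "w (k + r + r) = w k" for k using w(1)[of k] by (simp add: mult_2 add.assoc)
    have wr: "lead k i j * cnj (w (k + r)) = follow k i j * cnj (w (Suc k + r))" for k
    proof -
      have "star_scalar s (lead (k + r) i j * w (k + r)) = star_scalar s (follow (k + r) i j * w (Suc (k + r)))"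
        unfolding w(2) ..
      then show ?thesis unfolding ij lead_twist follow_twist by (simp add: st)
    qed
    \<comment> \<open>Symmetrise the kernel vector; if the symmetric part vanishes, multiply by \<open>\<i>\<close> instead.\<close>
    show ?thesis
    proof (cases "\<exists>k. w k + cnj (w (k + r)) \<noteq> 0")
      case True
      define v where "v k = w k + cnj (w (k + r))" for k
      have "v (k + 2 * r) = v k" "v (k + r) = cnj (v k)" for k
        unfolding v_def using w(1)[of k] w(1)[of "k + r"] w2[of k] by (simp_all add: ac_simps)
      moreover have "lead k i j * v k = follow k i j * v (Suc k)" for k
        unfolding v_def distrib_left w(2) wr ..
      ultimately show ?thesis using True unfolding v_def[symmetric] st by blast
    next
      case False
      define v where "v k = \<i> * w k" for k
      have "cnj (w (k + r)) = - w k" for k using False by (metis add.commute eq_neg_iff_add_eq_0)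
      then have "w (k + r) = - cnj (w k)" for k by (metis complex_cnj_cnj complex_cnj_minus)
      then have "v (k + r) = cnj (v k)" for k unfolding v_def by simp
      moreover have "v (k + 2 * r) = v k" for k unfolding v_def w(1) ..
      moreover have "lead k i j * v k = follow k i j * v (Suc k)" for k
        unfolding v_def using w(2)[of k] by (simp add: algebra_simps)
      moreover have "\<exists>k. v k \<noteq> 0" unfolding v_def using w(3) by simp
      ultimately show ?thesis unfolding st by blast
    qed
  qed
qed

text \<open>
  Back substitution, from the highest level down. Starting from a family that satisfies all
  equations at levels \<open>\<ge> m\<close>, a correction at level \<open>m - 1\<close> repairs the equations there without
  affecting the higher ones. Only the pairs with \<open>i \<le> j\<close> are corrected by a cyclic equation; the
  others are determined by the twist. The freedom in \<open>y0\<close> serves both existence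
  (\<open>y0 = 0\<close>) and the construction of kernel elements.
\<close>

lemma extend_solution:
  assumes f: "twisted s r f" and y0: "twisted s r y0"
    and above: "\<And>k i j. i < n \<Longrightarrow> j < n \<Longrightarrow> m \<le> i + j \<Longrightarrow> sylvester y0 k i j = f k i j"
    and below: "\<And>i j. i < n \<Longrightarrow> j < n \<Longrightarrow> i + j < m \<Longrightarrow> nonresonant i j"
  shows "\<exists>y. twisted s r y \<and> (\<forall>k i j. m \<le> i + j \<longrightarrow> y k i j = y0 k i j) \<and>
    (\<forall>k i j. i < n \<longrightarrow> j < n \<longrightarrow> sylvester y k i j = f k i j)"
  using y0 above below
proof (induction m arbitrary: y0)
  case 0
  then show ?case by auto
next
  case (Suc m)
  note y0 = Suc.prems(1)
  define g where "g k i j = f k i j - sylvester y0 k i j" for k i j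
  have g: "twisted s r g"
    unfolding twisted_def g_def
    using twistedD[OF f] twistedD[OF twisted_sylvester[OF y0]] by simp
  have "\<exists>w. (\<forall>k. w (k + 2 * r) = w k) \<and> (i = j \<longrightarrow> (\<forall>k. w (k + r) = star_scalar s (w k))) \<and>
    (\<forall>k. lead k i j * w k - follow k i j * w (Suc k) = g k i j)" if "i < n" "j < n" "i + j = m" for i j
    by (rule block_solution) (use that Suc.prems(3) twisted_periodic[OF g] twistedD[OF g] in auto)
  then have "\<forall>i j. \<exists>w. i < n \<and> j < n \<and> i + j = m \<longrightarrow>
     (\<forall>k. w (k + 2 * r) = w k) \<and> (i = j \<longrightarrow> (\<forall>k. w (k + r) = star_scalar s (w k))) \<and>
    (\<forall>k. lead k i j * w k - follow k i j * w (Suc k) = g k i j)" by blast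
  then obtain w where w: "\<And>i j. i < n \<Longrightarrow> j < n \<Longrightarrow> i + j = m \<Longrightarrow>
     (\<forall>k. w i j (k + 2 * r) = w i j k) \<and> (i = j \<longrightarrow> (\<forall>k. w i j (k + r) = star_scalar s (w i j k))) \<and>
    (\<forall>k. lead k i j * w i j k - follow k i j * w i j (Suc k) = g k i j)" by metis
  define d where "d k i j = (if i < n \<and> j < n \<and> i + j = m
    then if i \<le> j then w i j k else star_scalar s (w j i (k + r)) else 0)" for k i j
  have d: "twisted s r d"
    unfolding twisted_def
  proof (intro allI)
    fix k i j
    show "d (k + r) i j = star_scalar s (d k j i)"
    proof (cases "i < n \<and> j < n \<and> i + j = m")
      case True
      consider "i < j" | "i = j" | "j < i" by linarith
      then show ?thesis
      proof cases
        case 3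
        have "w j i (k + 2 * r) = w j i k" using w[of j i] True by (simp add: add.commute)
        then have "w j i (k + r + r) = w j i k" by (simp add: mult_2 add.assoc)
        then show ?thesis using 3 True by (simp add: d_def add.commute[of j i])
      qed (use w True in \<open>auto simp: d_def\<close>)
    qed (auto simp: d_def)
  qed
  define y1 where "y1 k i j = y0 k i j + d k i j" for k i j
  have y1: "twisted s r y1"
    unfolding twisted_def y1_def using twistedD[OF y0] twistedD[OF d] by simp
  have y1y0: "y1 k i j = y0 k i j" if "Suc m \<le> i + j" for k i j
    unfolding y1_def d_def using that by simp
  have diff: "sylvester y1 k i j - sylvester y0 k i j = lead k i j * d k i j - follow k i j * d (Suc k) i j"
    if "i < n" "j < n" "m \<le> i + j" for k i j
  proof -
    have "y1 l a b = y0 l a b" if "i \<le> a" "j \<le> b" "(a, b) \<noteq> (i, j)" for l a b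
      using that \<open>m \<le> i + j\<close> by (intro y1y0) (auto simp: order.order_iff_strict)
    then show ?thesis using sylvester_diff[of i j y1 y0 k] that by (simp add: y1_def)
  qed
  have upper: "sylvester y1 k i j = f k i j" if "i < n" "j < n" "i + j = m" "i \<le> j" for k i j
    using diff[of i j k] w[of i j] that by (simp add: d_def g_def)
  have "sylvester y1 k i j = f k i j" if ij: "i < n" "j < n" "m \<le> i + j" for k i j
  proof -
    consider "i + j = m" "i \<le> j" | "i + j = m" "j < i" | "Suc m \<le> i + j" using ij by linarith
    then show ?thesis
    proof cases
      case 1
      then show ?thesis using upper that by blast
    next
      case 2
      \<comment> \<open>The equation at \<open>(i, j)\<close> is the star of the equation at \<open>(j, i)\<close>, \<open>r\<close> steps further on.\<close>
      then have "star_scalar s (sylvester y1 k i j) = star_scalar s (f k i j)"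
        using upper[of j i "k + r"] that
        by (simp add: twistedD[OF twisted_sylvester[OF y1]] twistedD[OF f] add.commute)
      then show ?thesis by (metis star_scalar_simps(1))
    next
      case 3
      then show ?thesis using diff[OF that, of k] Suc.prems(2) that by (simp add: d_def)
    qed
  qed
  then obtain y where "twisted s r y" "\<forall>k i j. m \<le> i + j \<longrightarrow> y k i j = y1 k i j"
    "\<forall>k i j. i < n \<longrightarrow> j < n \<longrightarrow> sylvester y k i j = f k i j"
    using Suc.IH[OF y1] Suc.prems(3) by (metis less_Suc_eq)
  then show ?case using y1y0 by (metis Suc_leD)
qed

lemma triangular_solution:
  assumes "\<And>i j. i < n \<Longrightarrow> j < n \<Longrightarrow> nonresonant i j" and f: "twisted s r f"
  shows "\<exists>y. twisted s r y \<and> (\<forall>k i j. i < n \<longrightarrow> j < n \<longrightarrow> sylvester y k i j = f k i j)"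
proof -
  have "sylvester (\<lambda>_ _ _. 0) k i j = f k i j" if "i < n" "j < n" "2 * n \<le> i + j" for k i j
    using that by linarith
  from extend_solution[OF f twisted_zero this assms(1)] show ?thesis by blast
qed

lemma sylvester_zero [simp]: "sylvester (\<lambda>_ _ _. 0) k i j = 0"
  unfolding sylvester_def by simp

text \<open>
  At a nonzero entry of the highest level, the equation reduces to its diagonal part.
\<close>

lemma triangular_unique:
  assumes nr: "\<And>i j. i < n \<Longrightarrow> j < n \<Longrightarrow> nonresonant i j" and y: "twisted s r y"
    and eq: "\<And>k i j. i < n \<Longrightarrow> j < n \<Longrightarrow> sylvester y k i j = 0"
  shows "i < n \<Longrightarrow> j < n \<Longrightarrow> y k i j = 0"
proof (induction "2 * n - (i + j)" arbitrary: i j k rule: less_induct)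
  case less
  have agree: "y l a b = 0" if "i \<le> a" "j \<le> b" "a < n" "b < n" "(a, b) \<noteq> (i, j)" for l a b
  proof -
    have "i + j < a + b" using that by (auto simp: order.order_iff_strict)
    then show ?thesis using that by (intro less.hyps) linarith+
  qed
  show ?case
  proof (rule block_unique[OF nr[OF less.prems], of "\<lambda>k. y k i j"])
    show "lead k i j * y k i j = follow k i j * y (Suc k) i j" for k
      using sylvester_diff[of i j y "\<lambda>_ _ _. 0" k] agree less.prems eq by simp
  qed (use twisted_periodic[OF y] twistedD[OF y] in auto)
qed

text \<open>
  Take a resonant position of the lowest possible level. A kernel element of its diagonal block,
  with its starred copy at the transposed position and zeros elsewhere, satisfies the equations at
  this level and above; as the lower levels are free of resonance, it extends to a solution of the homogeneous system.
\<close>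

lemma triangular_kernel:
  assumes i: "i < n" and j: "j < n" and res: "\<not> nonresonant i j"
  shows "\<exists>y. twisted s r y \<and> (\<forall>k i j. i < n \<longrightarrow> j < n \<longrightarrow> sylvester y k i j = 0) \<and>
    (\<exists>k i j. i < n \<and> j < n \<and> y k i j \<noteq> 0)"
proof -
  define resonant_level where
    "resonant_level m \<longleftrightarrow> (\<exists>i j. i < n \<and> j < n \<and> i + j = m \<and> \<not> nonresonant i j)" for m
  define m where "m = Least resonant_level"
  have "resonant_level (i + j)" unfolding resonant_level_def using i j res by blast
  then have "resonant_level m" unfolding m_def by (rule LeastI)
  then obtain p q where pq: "p < n" "q < n" "p + q = m" "\<not> nonresonant p q"
    unfolding resonant_level_def by blast
  have min: "nonresonant i j" if "i < n" "j < n" "i + j < m" for i j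
    using not_less_Least[of "i + j" resonant_level] that unfolding m_def resonant_level_def by blast
  obtain w where w: "\<And>k. w (k + 2 * r) = w k" "p = q \<longrightarrow> (\<forall>k. w (k + r) = star_scalar s (w k))"
    "\<And>k. lead k p q * w k = follow k p q * w (Suc k)" "\<exists>k. w k \<noteq> 0"
    using block_kernel[OF pq(4)] by blast
  define d where "d k i j = (if (i, j) = (p, q) then w k
    else if (i, j) = (q, p) then star_scalar s (w (k + r)) else 0)" for k i j
  have d0: "d k i j = 0" if "(i, j) \<noteq> (p, q)" "(i, j) \<noteq> (q, p)" for k i j
    unfolding d_def if_not_P[OF that(1)] if_not_P[OF that(2)] ..
  have w2: "w (k + r + r) = w k" for k using w(1)[of k] by (simp add: mult_2 add.assoc)
  have d: "twisted s r d"
    unfolding twisted_def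
  proof (intro allI)
    fix k i j
    consider "(i, j) = (p, q)" "p = q" | "(i, j) = (p, q)" "p \<noteq> q" | "(i, j) = (q, p)" "p \<noteq> q"
      | "(i, j) \<noteq> (p, q)" "(i, j) \<noteq> (q, p)" by blast
    then show "d (k + r) i j = star_scalar s (d k j i)"
    proof cases
      case 1
      then show ?thesis using w(2) by (simp add: d_def)
    next
      case 2
      then show ?thesis by (simp add: d_def)
    next
      case 3
      then show ?thesis using w2[of k] by (simp add: d_def)
    next
      case 4
      then have "(j, i) \<noteq> (p, q)" "(j, i) \<noteq> (q, p)" by blast+
      then have "d k j i = 0" by (rule d0)
      then show ?thesis using d0[OF 4] by simp
    qed
  qed
  have dsum: "d k a b = 0" if "a + b \<noteq> m" for k a b
  proof -
    have "(a, b) \<noteq> (p, q)" "(a, b) \<noteq> (q, p)" using that pq(3) by auto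
    then show ?thesis by (rule d0)
  qed
  have val: "sylvester d k i j = lead k i j * d k i j - follow k i j * d (Suc k) i j"
    if "i < n" "j < n" "m \<le> i + j" for k i j
  proof -
    have "d l a b = 0" if "i \<le> a" "j \<le> b" "(a, b) \<noteq> (i, j)" for l a b
      using that \<open>m \<le> i + j\<close> by (intro dsum) (auto simp: order.order_iff_strict)
    then show ?thesis using sylvester_diff[of i j d "\<lambda>_ _ _. 0" k] that by auto
  qed
  have pqz: "sylvester d k p q = 0" for k
    using val[of p q k] pq w(3) by (simp add: d_def)
  have "sylvester d k i j = 0" if "i < n" "j < n" "m \<le> i + j" for k i j
  proof -
    consider "(i, j) = (p, q)" | "(i, j) = (q, p)" | "(i, j) \<noteq> (p, q)" "(i, j) \<noteq> (q, p)" by blast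
    then show ?thesis
    proof cases
      case 2
      then have "star_scalar s (sylvester d k i j) = 0"
        using twistedD[OF twisted_sylvester[OF d], of k p q] pqz[of "k + r"] by simp
      then show ?thesis by simp
    next
      case 1
      then show ?thesis using pqz by simp
    next
      case 3
      then show ?thesis using val[OF that, of k] d0[OF 3] by simp
    qed
  qed
  then obtain y where y: "twisted s r y" "\<forall>k i j. m \<le> i + j \<longrightarrow> y k i j = d k i j"
    "\<forall>k i j. i < n \<longrightarrow> j < n \<longrightarrow> sylvester y k i j = 0"
    using extend_solution[OF twisted_zero d, of m] min by blast
  obtain k where "w k \<noteq> 0" using w(4) by blast
  then have "y k p q \<noteq> 0" using y(2)[rule_format, of p q k] pq(3) by (simp add: d_def)
  then have "\<exists>k i j. i < n \<and> j < n \<and> y k i j \<noteq> 0" using pq(1,2) by blast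
  with y(1,3) show ?thesis by (intro exI[of _ y] conjI)
qed

end

section \<open>Twisted families of matrices\<close>

lemma star_mat_carrier [simp]: "A \<in> carrier_mat m n \<Longrightarrow> star_mat s A \<in> carrier_mat n m"
  by (cases s) auto

lemma star_mat_dims [simp]:
  "dim_row (star_mat s A) = dim_col A" "dim_col (star_mat s A) = dim_row A"
  by (cases s; simp)+

lemma star_mat_index [simp]:
  "i < dim_col A \<Longrightarrow> j < dim_row A \<Longrightarrow> star_mat s A $$ (i, j) = star_scalar s (A $$ (j, i))"
  by (cases s) simp_all

lemma star_mat_star_mat [simp]: "star_mat s (star_mat s A) = A"
  by (rule eq_matI) simp_all

lemma star_mat_one [simp]: "star_mat s (1\<^sub>m n) = 1\<^sub>m n"
  by (rule eq_matI) (cases s; simp)+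

lemma star_mat_mult:
  "A \<in> carrier_mat m n \<Longrightarrow> B \<in> carrier_mat n l \<Longrightarrow> star_mat s (A * B) = star_mat s B * star_mat s A"
  by (rule eq_matI)
    (auto simp: scalar_prod_def star_scalar_sum mult.commute intro!: sum.cong)

lemma star_mat_minus:
  "A \<in> carrier_mat m n \<Longrightarrow> B \<in> carrier_mat m n \<Longrightarrow> star_mat s (A - B) = star_mat s A - star_mat s B"
  by (rule eq_matI) auto

text \<open>
  Matrix versions of \<open>twisted\<close> and \<open>sylvester\<close>, for arbitrary coefficients: these become
  triangular only after the Schur decomposition.
\<close>

definition twisted_family :: "star_op \<Rightarrow> nat \<Rightarrow> nat \<Rightarrow> (nat \<Rightarrow> complex mat) \<Rightarrow> bool" where
  "twisted_family s n r Y \<longleftrightarrow> (\<forall>k. Y k \<in> carrier_mat n n \<and> Y (k + r) = star_mat s (Y k))"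

definition sylvester_family ::
  "star_op \<Rightarrow> nat \<Rightarrow> (nat \<Rightarrow> complex mat) \<Rightarrow> (nat \<Rightarrow> complex mat) \<Rightarrow> (nat \<Rightarrow> complex mat) \<Rightarrow> nat \<Rightarrow> complex mat" where
  "sylvester_family s r M N Y k =
     M k * Y k * star_mat s (M (k + r)) - N k * Y (Suc k) * star_mat s (N (k + r))"

definition twisted_nonsingular ::
  "star_op \<Rightarrow> nat \<Rightarrow> nat \<Rightarrow> (nat \<Rightarrow> complex mat) \<Rightarrow> (nat \<Rightarrow> complex mat) \<Rightarrow> bool" where
  "twisted_nonsingular s n r M N \<longleftrightarrow>
     (\<forall>E. twisted_family s n r E \<longrightarrow> (\<exists>!Y. twisted_family s n r Y \<and> sylvester_family s r M N Y = E))"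

lemma twisted_familyD:
  assumes "twisted_family s n r Y"
  shows "Y k \<in> carrier_mat n n" "Y (k + r) = star_mat s (Y k)"
  using assms unfolding twisted_family_def by blast+

lemma ex1_bijection:
  assumes "\<And>x. P x \<Longrightarrow> Q (f x)" "\<And>y. Q y \<Longrightarrow> P (g y)"
    and "\<And>x. P x \<Longrightarrow> g (f x) = x" "\<And>y. Q y \<Longrightarrow> f (g y) = y"
  shows "(\<exists>!x. P x) \<longleftrightarrow> (\<exists>!y. Q y)"
proof
  assume "\<exists>!x. P x"
  then obtain x where x: "P x" "\<And>z. P z \<Longrightarrow> z = x" by blast
  show "\<exists>!y. Q y"
  proof (rule ex1I[of _ "f x"])
    fix y assume "Q y"
    then show "y = f x" using assms(2,4) x(2)[of "g y"] by metis
  qed (rule assms(1)[OF x(1)])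
next
  assume "\<exists>!y. Q y"
  then obtain y where y: "Q y" "\<And>z. Q z \<Longrightarrow> z = y" by blast
  show "\<exists>!x. P x"
  proof (rule ex1I[of _ "g y"])
    fix x assume "P x"
    then show "x = g y" using assms(1,3) y(2)[of "f x"] by metis
  qed (rule assms(2)[OF y(1)])
qed

lemma twisted_sylvester_family:
  assumes M: "\<And>k. M k \<in> carrier_mat n n" "\<And>k. M (k + 2 * r) = M k"
    and N: "\<And>k. N k \<in> carrier_mat n n" "\<And>k. N (k + 2 * r) = N k"
    and Y: "twisted_family s n r Y"
  shows "twisted_family s n r (sylvester_family s r M N Y)"
  unfolding twisted_family_def
proof (intro allI conjI)
  fix k
  note Yc = twisted_familyD(1)[OF Y] and Yr = twisted_familyD(2)[OF Y]
  have MM: "M (k + r + r) = M k" and NN: "N (k + r + r) = N k"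
    using M(2)[of k] N(2)[of k] by (simp_all add: mult_2 add.assoc)
  have c: "F * G * star_mat s H \<in> carrier_mat n n"
    if "F \<in> carrier_mat n n" "G \<in> carrier_mat n n" "H \<in> carrier_mat n n" for F G H
    using that by (auto intro!: mult_carrier_mat[of _ n n])
  have st: "star_mat s (F * G * star_mat s H) = H * star_mat s G * star_mat s F"
    if "F \<in> carrier_mat n n" "G \<in> carrier_mat n n" "H \<in> carrier_mat n n" for F G H
  proof -
    have FG: "F * G \<in> carrier_mat n n" using that by (auto intro!: mult_carrier_mat[of _ n n])
    have "star_mat s (F * G * star_mat s H) = H * (star_mat s G * star_mat s F)"
      using star_mat_mult[OF FG, of "star_mat s H" n s] star_mat_mult[OF that(1,2), of s] that by simp
    also have "\<dots> = H * star_mat s G * star_mat s F"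
      by (rule assoc_mult_mat[symmetric]) (use that in auto)
    finally show ?thesis .
  qed
  show "sylvester_family s r M N Y k \<in> carrier_mat n n"
    unfolding sylvester_family_def using c[OF N(1) Yc N(1)] by (rule minus_carrier_mat)
  have "star_mat s (sylvester_family s r M N Y k) =
    star_mat s (M k * Y k * star_mat s (M (k + r))) - star_mat s (N k * Y (Suc k) * star_mat s (N (k + r)))"
    unfolding sylvester_family_def by (rule star_mat_minus[OF c[OF M(1) Yc M(1)] c[OF N(1) Yc N(1)]])
  also have "\<dots> = sylvester_family s r M N Y (k + r)"
    unfolding st[OF M(1) Yc M(1)] st[OF N(1) Yc N(1)] sylvester_family_def MM NN Yr[symmetric] add_Suc[symmetric] ..
  finally show "sylvester_family s r M N Y (k + r) = star_mat s (sylvester_family s r M N Y k)" ..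
qed

text \<open>
  This reduces the uniform equation to its instances with \<open>k < r\<close>.
\<close>

lemma twisted_family_eqI:
  assumes r: "0 < r" and F: "twisted_family s n r F" and G: "twisted_family s n r G"
    and eq: "\<And>k. k < r \<Longrightarrow> F k = G k"
  shows "F = G"
proof
  fix k
  show "F k = G k"
  proof (induction k rule: less_induct)
    case (less k)
    show ?case
    proof (cases "k < r")
      case False
      then have "F (k - r + r) = G (k - r + r)"
        unfolding twisted_familyD(2)[OF F] twisted_familyD(2)[OF G] using less[of "k - r"] r by simp
      then show ?thesis using False by simp
    qed (rule eq)
  qed
qed

section \<open>Unfolding the tuple of unknowns\<close>

lemma join_star_carrier:
  assumes "\<And>k. k \<in> {1..r} \<Longrightarrow> F k \<in> carrier_mat n n" "\<And>k. k \<in> {1..r} \<Longrightarrow> G k \<in> carrier_mat n n"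
    and "k \<in> {1..2 * r}"
  shows "join_star s r F G k \<in> carrier_mat n n"
proof (cases "k \<le> r")
  case True
  then show ?thesis using assms(1)[of k] assms(3) unfolding join_star_def by simp
next
  case False
  then have "k - r \<in> {1..r}" using assms(3) by auto
  then show ?thesis using assms(2)[of "k - r"] False unfolding join_star_def by simp
qed

text \<open>
  The twisted family \<open>X\<^sub>1, \<dots>, X\<^sub>r, X\<^sub>1\<^sup>\<star>, \<dots>, X\<^sub>r\<^sup>\<star>, X\<^sub>1, \<dots>\<close>, indexed from \<open>0\<close>.
\<close>

definition unfold_star :: "star_op \<Rightarrow> nat \<Rightarrow> (nat \<Rightarrow> complex mat) \<Rightarrow> nat \<Rightarrow> complex mat" where
  "unfold_star s r X k = join_star s r X X (Suc (k mod (2 * r)))"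

lemma unfold_star_low: "k < r \<Longrightarrow> unfold_star s r X k = X (Suc k)"
  unfolding unfold_star_def join_star_def by simp

lemma unfold_star_twisted:
  assumes r: "0 < r" and X: "\<And>k. k \<in> {1..r} \<Longrightarrow> X k \<in> carrier_mat n n"
  shows "twisted_family s n r (unfold_star s r X)"
  unfolding twisted_family_def
proof (intro allI conjI)
  fix k
  define l where "l = k mod (2 * r)"
  have l: "l < 2 * r" unfolding l_def using r by simp
  have kr: "(k + r) mod (2 * r) = (if l < r then l + r else l - r)"
  proof -
    have "(k + r) mod (2 * r) = (l + r) mod (2 * r)" unfolding l_def by (rule mod_add_left_eq[symmetric])
    also have "\<dots> = (if l < r then l + r else l - r)"
    proof (cases "l < r")
      case False
      then have "l + r = (l - r) + 2 * r" by simp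
      then have "(l + r) mod (2 * r) = (l - r) mod (2 * r)" by (metis mod_add_self2)
      then show ?thesis using False l by simp
    qed simp
    finally show ?thesis .
  qed
  show "unfold_star s r X k \<in> carrier_mat n n"
    unfolding unfold_star_def l_def[symmetric] by (rule join_star_carrier[OF X X]) (use l in auto)
  show "unfold_star s r X (k + r) = star_mat s (unfold_star s r X k)"
    unfolding unfold_star_def join_star_def kr l_def[symmetric] using l by (auto simp: Suc_diff_le)
qed

text \<open>
  Unfolding is a bijection between tuples of unknowns and twisted families. Since \<open>M (k + r)\<^sup>\<star>\<close> is
  \<open>B\<close> and \<open>N (k + r)\<^sup>\<star>\<close> is \<open>D\<close>, and since the unknown that follows \<open>X\<^sub>r\<close> is \<open>X\<^sub>1\<^sup>\<star>\<close>, the first \<open>r\<close>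
  instances of the uniform equation are exactly the given system.
\<close>

lemma nonsingular_iff_twisted_nonsingular:
  fixes s :: star_op
  assumes r: "0 < r"
    and A: "\<And>k. k \<in> {1..r} \<Longrightarrow> A k \<in> carrier_mat n n" and B: "\<And>k. k \<in> {1..r} \<Longrightarrow> B k \<in> carrier_mat n n"
    and C: "\<And>k. k \<in> {1..r} \<Longrightarrow> C k \<in> carrier_mat n n" and D: "\<And>k. k \<in> {1..r} \<Longrightarrow> D k \<in> carrier_mat n n"
  defines "M \<equiv> \<lambda>k. join_star s r A B (Suc (k mod (2 * r)))"
    and "N \<equiv> \<lambda>k. join_star s r C D (Suc (k mod (2 * r)))"
  shows "nonsingular_system s n r A B C D \<longleftrightarrow> twisted_nonsingular s n r M N"
proof -
  let ?U = "unfold_star s r"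
  have "Suc (k mod (2 * r)) \<in> {1..2 * r}" for k using r by (simp add: Suc_le_eq)
  note join = join_star_carrier[OF _ _ this]
  have M: "M k \<in> carrier_mat n n" "M (k + 2 * r) = M k" and N: "N k \<in> carrier_mat n n" "N (k + 2 * r) = N k" for k
    unfolding M_def N_def using join[where F = A and G = B, OF A B] join[where F = C and G = D, OF C D] by simp_all
  note UT = unfold_star_twisted[where s = s and r = r and n = n, OF r]
  have solves: "solves_system s r A B C D E X \<longleftrightarrow> sylvester_family s r M N (?U X) = ?U E"
    if X: "\<And>k. k \<in> {1..r} \<Longrightarrow> X k \<in> carrier_mat n n" and E: "\<And>k. k \<in> {1..r} \<Longrightarrow> E k \<in> carrier_mat n n" for E X
  proof -
    note UX = UT[where X = X, OF X] and UE = UT[where X = E, OF E]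
    have "sylvester_family s r M N (?U X) = ?U E \<longleftrightarrow> (\<forall>k<r. sylvester_family s r M N (?U X) k = ?U E k)"
      using twisted_family_eqI[OF r twisted_sylvester_family[where M = M and N = N, OF M N UX] UE] by auto
    also have "\<dots> \<longleftrightarrow> (\<forall>k<r. A (Suc k) * X (Suc k) * B (Suc k) -
      C (Suc k) * (if Suc k < r then X (Suc (Suc k)) else star_mat s (X 1)) * D (Suc k) = E (Suc k))"
    proof (intro all_cong1 imp_cong refl)
      fix k assume k: "k < r"
      have "M k = A (Suc k)" "N k = C (Suc k)" "star_mat s (M (k + r)) = B (Suc k)" "star_mat s (N (k + r)) = D (Suc k)"
        unfolding M_def N_def join_star_def using k by simp_all
      moreover have "?U X (Suc k) = (if Suc k < r then X (Suc (Suc k)) else star_mat s (X 1))"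
      proof (cases "Suc k < r")
        case False
        then have "Suc k = 0 + r" using k by simp
        then have "?U X (Suc k) = star_mat s (?U X 0)" using twisted_familyD(2)[OF UX, where k = 0] by simp
        then show ?thesis using False unfold_star_low[OF r, of s X] by simp
      qed (simp add: unfold_star_low)
      ultimately show "sylvester_family s r M N (?U X) k = ?U E k \<longleftrightarrow>
        A (Suc k) * X (Suc k) * B (Suc k) -
        C (Suc k) * (if Suc k < r then X (Suc (Suc k)) else star_mat s (X 1)) * D (Suc k) = E (Suc k)"
        unfolding sylvester_family_def using unfold_star_low[OF k, of s X] unfold_star_low[OF k, of s E] by simp
    qed
    also have "\<dots> \<longleftrightarrow> solves_system s r A B C D E X" (is "?L \<longleftrightarrow> _")
    proof
      assume L: ?L
      show "solves_system s r A B C D E X" unfolding solves_system_def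
      proof (intro conjI ballI)
        fix k assume "k \<in> {1..<r}"
        then show "A k * X k * B k - C k * X (k + 1) * D k = E k" using L[rule_format, of "k - 1"] by auto
      next
        show "A r * X r * B r - C r * star_mat s (X 1) * D r = E r" using L[rule_format, of "r - 1"] r by auto
      qed
    next
      assume S: "solves_system s r A B C D E X"
      show ?L
      proof (intro allI impI)
        fix k assume k: "k < r"
        show "A (Suc k) * X (Suc k) * B (Suc k) -
          C (Suc k) * (if Suc k < r then X (Suc (Suc k)) else star_mat s (X 1)) * D (Suc k) = E (Suc k)"
        proof (cases "Suc k < r")
          case True
          then show ?thesis using S unfolding solves_system_def by auto
        next
          case False
          then have "Suc k = r" using k by simp
          then show ?thesis using S unfolding solves_system_def by auto
        qed
      qed
    qed
    finally show ?thesis by blast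
  qed
  let ?G = "\<lambda>Y. restrict (\<lambda>k. Y (k - 1)) {1..r}"
  have fold_unfold: "?G (?U X) = X" if "X \<in> {1..r} \<rightarrow>\<^sub>E carrier_mat n n" for X
  proof
    fix k
    show "?G (?U X) k = X k"
      using that unfold_star_low[of "k - 1" r s X] by (cases "k \<in> {1..r}") (auto simp: PiE_def extensional_def)
  qed
  have unfold_fold: "?U (?G Y) = Y" if Y: "twisted_family s n r Y" for Y
  proof (rule twisted_family_eqI[OF r _ Y])
    show "twisted_family s n r (?U (?G Y))"
      by (rule unfold_star_twisted[OF r]) (use twisted_familyD(1)[OF Y] in simp)
    show "?U (?G Y) k = Y k" if "k < r" for k using unfold_star_low[OF that, of s "?G Y"] that by simp
  qed
  have unique: "(\<exists>!X. X \<in> {1..r} \<rightarrow>\<^sub>E carrier_mat n n \<and> solves_system s r A B C D E X) \<longleftrightarrow>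
    (\<exists>!Y. twisted_family s n r Y \<and> sylvester_family s r M N Y = ?U E)"
    if E: "\<And>k. k \<in> {1..r} \<Longrightarrow> E k \<in> carrier_mat n n" for E
  proof (rule ex1_bijection[where f = ?U and g = ?G])
    fix X assume X: "X \<in> {1..r} \<rightarrow>\<^sub>E carrier_mat n n \<and> solves_system s r A B C D E X"
    then have Xc: "X k \<in> carrier_mat n n" if "k \<in> {1..r}" for k using that by (auto simp: PiE_iff)
    show "twisted_family s n r (?U X) \<and> sylvester_family s r M N (?U X) = ?U E"
      using UT[where X = X, OF Xc] solves[where X = X and E = E, OF Xc E] X by simp
  next
    fix Y assume Y: "twisted_family s n r Y \<and> sylvester_family s r M N Y = ?U E"
    then have Yc: "?G Y k \<in> carrier_mat n n" if "k \<in> {1..r}" for k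
      using twisted_familyD(1)[of s n r Y] that by simp
    have "?G Y \<in> {1..r} \<rightarrow>\<^sub>E carrier_mat n n" using Yc by (auto simp: PiE_iff)
    moreover have "solves_system s r A B C D E (?G Y)"
      using solves[where X = "?G Y" and E = E, OF Yc E] unfold_fold[of Y] Y by simp
    ultimately show "?G Y \<in> {1..r} \<rightarrow>\<^sub>E carrier_mat n n \<and> solves_system s r A B C D E (?G Y)" ..
  qed (use fold_unfold unfold_fold in blast)+
  show ?thesis
    unfolding nonsingular_system_def twisted_nonsingular_def
  proof (intro iffI allI impI)
    fix E :: "nat \<Rightarrow> complex mat"
    assume L: "\<forall>E. (\<forall>k\<in>{1..r}. E k \<in> carrier_mat n n) \<longrightarrow>
        (\<exists>!X. X \<in> {1..r} \<rightarrow>\<^sub>E carrier_mat n n \<and> solves_system s r A B C D E X)"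
      and E: "twisted_family s n r E"
    have "?G E k \<in> carrier_mat n n" if "k \<in> {1..r}" for k using twisted_familyD(1)[OF E] that by simp
    then show "\<exists>!Y. twisted_family s n r Y \<and> sylvester_family s r M N Y = E"
      using L[rule_format, of "?G E"] unique[of "?G E"] unfold_fold[OF E] by simp
  next
    fix E :: "nat \<Rightarrow> complex mat"
    assume R: "\<forall>E. twisted_family s n r E \<longrightarrow> (\<exists>!Y. twisted_family s n r Y \<and> sylvester_family s r M N Y = E)"
      and E: "\<forall>k\<in>{1..r}. E k \<in> carrier_mat n n"
    then have Ec: "E k \<in> carrier_mat n n" if "k \<in> {1..r}" for k using that by blast
    have "\<exists>!Y. twisted_family s n r Y \<and> sylvester_family s r M N Y = ?U E"
      using R UT[where X = E, OF Ec] by blast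
    then show "\<exists>!X. X \<in> {1..r} \<rightarrow>\<^sub>E carrier_mat n n \<and> solves_system s r A B C D E X"
      using unique[of E, OF Ec] by simp
  qed
qed

section \<open>Unitary changes of variables\<close>

text \<open>
  A change of variables. Taking the factor on the right from the same sequence, \<open>r\<close> steps further
  on, is what makes it preserve twisted families.
\<close>

definition star_conj :: "star_op \<Rightarrow> nat \<Rightarrow> (nat \<Rightarrow> complex mat) \<Rightarrow> (nat \<Rightarrow> complex mat) \<Rightarrow> nat \<Rightarrow> complex mat" where
  "star_conj s r U X k = U k * X k * star_mat s (U (k + r))"

lemma star_conj_twisted:
  assumes U: "\<And>k. U k \<in> carrier_mat n n" "\<And>k. U (k + 2 * r) = U k" and X: "twisted_family s n r X"
  shows "twisted_family s n r (star_conj s r U X)"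
proof -
  have "star_conj s r U X k = sylvester_family s r U (\<lambda>_. 0\<^sub>m n n) X k" for k
  proof -
    note Xc = twisted_familyD(1)[OF X]
    have "0\<^sub>m n n * X (Suc k) * star_mat s (0\<^sub>m n n) = 0\<^sub>m n n"
      using left_mult_zero_mat[OF Xc, of n] left_mult_zero_mat[of "star_mat s (0\<^sub>m n n)" n n n] by simp
    moreover have "U k * X k * star_mat s (U (k + r)) \<in> carrier_mat n n"
      using U Xc by (auto intro!: mult_carrier_mat[of _ n n])
    ultimately show ?thesis unfolding sylvester_family_def star_conj_def by (auto intro!: eq_matI)
  qed
  then have "star_conj s r U X = sylvester_family s r U (\<lambda>_. 0\<^sub>m n n) X" by blast
  then show ?thesis 
    using twisted_sylvester_family[where M = U and N = "\<lambda>_. 0\<^sub>m n n" and Y = X] U X by simp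
qed

lemma star_conj_inverse:
  assumes U: "\<And>k. U k \<in> carrier_mat n n" and V: "\<And>k. V k \<in> carrier_mat n n" and VU: "\<And>k. V k * U k = 1\<^sub>m n"
    and X: "\<And>k. X k \<in> carrier_mat n n"
  shows "star_conj s r V (star_conj s r U X) = X"
proof
  fix k
  let ?c = "carrier_mat n n"
  let ?u = "star_mat s (U (k + r))" and ?v = "star_mat s (V (k + r))"
  have uc: "?u \<in> ?c" "?v \<in> ?c" using U V by simp_all
  have UX: "U k * X k \<in> ?c" by (rule mult_carrier_mat[OF U X])
  have uv: "?u * ?v = 1\<^sub>m n" using star_mat_mult[OF V U, of s] VU[of "k + r"] by (metis star_mat_one)
  have "star_conj s r V (star_conj s r U X) k = V k * (U k * X k * ?u) * ?v" unfolding star_conj_def ..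
  also have "V k * (U k * X k * ?u) = V k * (U k * X k) * ?u"
    by (rule assoc_mult_mat[OF V UX uc(1), symmetric])
  also have "V k * (U k * X k) = X k"
    using assoc_mult_mat[OF V U X, of k k k] VU[of k] left_mult_one_mat[OF X] by simp
  also have "X k * ?u * ?v = X k"
    using assoc_mult_mat[OF X uc, of k] uv right_mult_one_mat[OF X] by simp
  finally show "star_conj s r V (star_conj s r U X) k = X k" .
qed

text \<open>
  The factors of the transformed coefficients regroup, because
  \<open>(P (k + r) * M (k + r) * Z (k + r))\<^sup>\<star> = Z (k + r)\<^sup>\<star> * M (k + r)\<^sup>\<star> * P (k + r)\<^sup>\<star>\<close>.
\<close>

lemma sylvester_family_conj:
  assumes P: "\<And>k. P k \<in> carrier_mat n n" and Z: "\<And>k. Z k \<in> carrier_mat n n"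
    and M: "\<And>k. M k \<in> carrier_mat n n" and N: "\<And>k. N k \<in> carrier_mat n n"
    and Y: "\<And>k. Y k \<in> carrier_mat n n"
  shows "sylvester_family s r (\<lambda>k. P k * M k * Z k) (\<lambda>k. P k * N k * Z (Suc k)) Y =
    star_conj s r P (sylvester_family s r M N (star_conj s r Z Y))"
proof
  fix k
  let ?c = "carrier_mat n n"
  have key: "P k * F * G * H * star_mat s (P (k + r) * F' * G') =
      P k * (F * (G * H * star_mat s G') * star_mat s F') * star_mat s (P (k + r))"
    if "F \<in> ?c" "G \<in> ?c" "H \<in> ?c" "F' \<in> ?c" "G' \<in> ?c" for F G H F' G'
  proof -
    let ?p = "star_mat s (P (k + r))" and ?f = "star_mat s F'" and ?g = "star_mat s G'"
    have c: "?p \<in> ?c" "?f \<in> ?c" "?g \<in> ?c" using P that by simp_all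
    note mc = mult_carrier_mat[where nr = n and n = n and nc = n]
    have PF': "P (k + r) * F' \<in> ?c" by (rule mc[OF P that(4)])
    have "star_mat s (P (k + r) * F' * G') = ?g * (?f * ?p)"
      using star_mat_mult[OF PF' that(5), of s] star_mat_mult[OF P that(4), of s "k + r"] by simp
    then show ?thesis using P[of k] that c
      by (simp add: assoc_mult_mat[where n\<^sub>1 = n and n\<^sub>2 = n and n\<^sub>3 = n and n\<^sub>4 = n] mc)
  qed
  note mc = mult_carrier_mat[where nr = n and n = n and nc = n]
  have conj: "star_conj s r Z Y l \<in> ?c" for l
    unfolding star_conj_def using Z Y by (simp add: mc)
  have dist: "P k * (F - G) * star_mat s (P (k + r)) = P k * F * star_mat s (P (k + r)) - P k * G * star_mat s (P (k + r))"
    if "F \<in> ?c" "G \<in> ?c" for F G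
    using that P[of k] P[of "k + r"] by (simp add: mult_minus_distrib_mat[of _ n n _ n] minus_mult_distrib_mat[of _ n n _ _ n] mc)
  show "sylvester_family s r (\<lambda>k. P k * M k * Z k) (\<lambda>k. P k * N k * Z (Suc k)) Y k =
    star_conj s r P (sylvester_family s r M N (star_conj s r Z Y)) k"
    unfolding sylvester_family_def star_conj_def[of s r P]
    using conj M N by (simp add: dist mc) (simp add: star_conj_def key M N Z Y)
qed

lemma twisted_nonsingular_conj:
  assumes r: "0 < r"
    and Q: "\<And>k. unitary_mat n (Q k)" "\<And>k. Q (k + 2 * r) = Q k"
    and Z: "\<And>k. unitary_mat n (Z k)" "\<And>k. Z (k + 2 * r) = Z k"
    and M: "\<And>k. M k \<in> carrier_mat n n" "\<And>k. M (k + 2 * r) = M k"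
    and N: "\<And>k. N k \<in> carrier_mat n n" "\<And>k. N (k + 2 * r) = N k"
  shows "twisted_nonsingular s n r (\<lambda>k. mat_adjoint (Q k) * M k * Z k) (\<lambda>k. mat_adjoint (Q k) * N k * Z (Suc k)) \<longleftrightarrow>
    twisted_nonsingular s n r M N"
    (is "twisted_nonsingular s n r ?T ?R \<longleftrightarrow> _")
proof -
  let ?Qa = "\<lambda>k. mat_adjoint (Q k)" and ?Za = "\<lambda>k. mat_adjoint (Z k)"
  have c: "Q k \<in> carrier_mat n n" "?Qa k \<in> carrier_mat n n" "Z k \<in> carrier_mat n n" "?Za k \<in> carrier_mat n n" for k
    using Q Z by (auto intro: unitary_carrier adjoint_carrier)
  have tw: "twisted_family s n r (star_conj s r Q X)" "twisted_family s n r (star_conj s r ?Qa X)"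
    "twisted_family s n r (star_conj s r Z X)" "twisted_family s n r (star_conj s r ?Za X)"
    if "twisted_family s n r X" for X
    by (rule star_conj_twisted[OF _ _ that]; (rule c)?; simp add: Q(2) Z(2))+
  have inv: "star_conj s r ?Qa (star_conj s r Q X) = X" "star_conj s r Q (star_conj s r ?Qa X) = X"
    "star_conj s r ?Za (star_conj s r Z X) = X" "star_conj s r Z (star_conj s r ?Za X) = X"
    if X: "twisted_family s n r X" for X
    using star_conj_inverse[of Q n ?Qa X s r] star_conj_inverse[of ?Qa n Q X s r]
      star_conj_inverse[of Z n ?Za X s r] star_conj_inverse[of ?Za n Z X s r]
      c unitary_left[OF Q(1)] unitary_right[OF Q(1)] unitary_left[OF Z(1)] unitary_right[OF Z(1)]
      twisted_familyD(1)[OF X] by blast+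
  have syl: "sylvester_family s r ?T ?R Y = star_conj s r ?Qa (sylvester_family s r M N (star_conj s r Z Y))"
    if "twisted_family s n r Y" for Y
    using sylvester_family_conj[of ?Qa n Z M N Y s r] c M N twisted_familyD(1)[OF that] by blast
  have syl_twisted: "twisted_family s n r (sylvester_family s r M N X)" if "twisted_family s n r X" for X
    by (rule twisted_sylvester_family[where M = M and N = N, OF M N that])
  have ex1: "(\<exists>!X. twisted_family s n r X \<and> sylvester_family s r M N X = E) \<longleftrightarrow>
    (\<exists>!Y. twisted_family s n r Y \<and> sylvester_family s r ?T ?R Y = star_conj s r ?Qa E)"
    if E: "twisted_family s n r E" for E
  proof (rule ex1_bijection[where f = "star_conj s r ?Za" and g = "star_conj s r Z"])
    fix X assume X: "twisted_family s n r X \<and> sylvester_family s r M N X = E"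
    then show "twisted_family s n r (star_conj s r ?Za X) \<and>
      sylvester_family s r ?T ?R (star_conj s r ?Za X) = star_conj s r ?Qa E"
      using syl[OF tw(4)] tw(4) inv(4) by simp
  next
    fix Y assume Y: "twisted_family s n r Y \<and> sylvester_family s r ?T ?R Y = star_conj s r ?Qa E"
    then have "star_conj s r ?Qa (sylvester_family s r M N (star_conj s r Z Y)) = star_conj s r ?Qa E"
      using syl[of Y] by simp
    then have "star_conj s r Q (star_conj s r ?Qa (sylvester_family s r M N (star_conj s r Z Y))) =
      star_conj s r Q (star_conj s r ?Qa E)" by simp
    then show "twisted_family s n r (star_conj s r Z Y) \<and> sylvester_family s r M N (star_conj s r Z Y) = E"
      using inv(2)[OF E] inv(2)[OF syl_twisted[OF tw(3)]] tw(3) Y by simp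
  qed (use inv in blast)+
  show ?thesis
    unfolding twisted_nonsingular_def
  proof (intro iffI allI impI)
    fix E
    assume L: "\<forall>E. twisted_family s n r E \<longrightarrow> (\<exists>!Y. twisted_family s n r Y \<and> sylvester_family s r ?T ?R Y = E)"
      and E: "twisted_family s n r E"
    show "\<exists>!Y. twisted_family s n r Y \<and> sylvester_family s r M N Y = E"
      unfolding ex1[OF E] using L tw(2)[OF E] by blast
  next
    fix E
    assume L: "\<forall>E. twisted_family s n r E \<longrightarrow> (\<exists>!Y. twisted_family s n r Y \<and> sylvester_family s r M N Y = E)"
      and E: "twisted_family s n r E"
    have "\<exists>!Y. twisted_family s n r Y \<and> sylvester_family s r M N Y = star_conj s r Q E"
      using L tw(1)[OF E] by blast
    then show "\<exists>!Y. twisted_family s n r Y \<and> sylvester_family s r ?T ?R Y = E"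
      unfolding ex1[OF tw(1)[OF E]] inv(1)[OF E] .
  qed
qed

section \<open>Solvability of the triangular system in terms of the diagonals\<close>

context triangular_star_system
begin

lemma sylvester_minus:
  "sylvester (\<lambda>k i j. y k i j - z k i j) k i j = sylvester y k i j - sylvester z k i j"
  unfolding sylvester_def sum_subtractf[symmetric] by (simp add: algebra_simps)

lemma sylvester_cong:
  assumes "\<And>k a b. a < n \<Longrightarrow> b < n \<Longrightarrow> y k a b = z k a b"
  shows "sylvester y k i j = sylvester z k i j"
  unfolding sylvester_def using assms by (intro sum.cong refl) simp

text \<open>
  Translation between families of matrices and functions of their indices. The default value \<open>0\<close>
  outside the matrix makes \<open>entries\<close> twisted for all indices.
\<close>

definition mat_family :: "(nat \<Rightarrow> nat \<Rightarrow> nat \<Rightarrow> complex) \<Rightarrow> nat \<Rightarrow> complex mat" where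
  "mat_family y k = mat n n (\<lambda>(i, j). y k i j)"

definition entries :: "(nat \<Rightarrow> complex mat) \<Rightarrow> nat \<Rightarrow> nat \<Rightarrow> nat \<Rightarrow> complex" where
  "entries Y k i j = (if i < n \<and> j < n then Y k $$ (i, j) else 0)"

lemma mat_family_twisted:
  assumes "twisted s r y"
  shows "twisted_family s n r (mat_family y)"
  unfolding twisted_family_def
proof (intro allI conjI)
  fix k
  show "mat_family y k \<in> carrier_mat n n" unfolding mat_family_def by simp
  show "mat_family y (k + r) = star_mat s (mat_family y k)"
    by (rule eq_matI) (use twistedD[OF assms] in \<open>simp_all add: mat_family_def\<close>)
qed

lemma entries_twisted:
  assumes Y: "twisted_family s n r Y"
  shows "twisted s r (entries Y)"
  unfolding twisted_def
proof (intro allI)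
  fix k i j
  have "dim_row (Y k) = n" "dim_col (Y k) = n" using twisted_familyD(1)[OF Y, of k] by auto
  then show "entries Y (k + r) i j = star_scalar s (entries Y k j i)"
    unfolding entries_def twisted_familyD(2)[OF Y] by simp
qed

lemma entries_mat_family: "i < n \<Longrightarrow> j < n \<Longrightarrow> entries (mat_family y) k i j = y k i j"
  unfolding entries_def mat_family_def by simp

lemma sylvester_family_index:
  assumes T: "\<And>k. T k \<in> carrier_mat n n" "\<And>k i j. i < n \<Longrightarrow> j < n \<Longrightarrow> T k $$ (i, j) = t k i j"
    and R: "\<And>k. R k \<in> carrier_mat n n" "\<And>k i j. i < n \<Longrightarrow> j < n \<Longrightarrow> R k $$ (i, j) = u k i j"
    and Y: "\<And>k. Y k \<in> carrier_mat n n" and i: "i < n" and j: "j < n"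
  shows "sylvester_family s r T R Y k $$ (i, j) = sylvester (entries Y) k i j"
proof -
  have prod: "(F * G * star_mat s H) $$ (i, j) = (\<Sum>a<n. \<Sum>b<n. F $$ (i, a) * G $$ (a, b) * star_scalar s (H $$ (j, b)))"
    if "F \<in> carrier_mat n n" "G \<in> carrier_mat n n" "H \<in> carrier_mat n n" for F G H
  proof -
    have "(F * G * star_mat s H) $$ (i, j) = (\<Sum>b<n. (\<Sum>a<n. F $$ (i, a) * G $$ (a, b)) * star_scalar s (H $$ (j, b)))"
      using that i j by (auto simp: scalar_prod_def atLeast0LessThan intro!: sum.cong)
    also have "\<dots> = (\<Sum>a<n. \<Sum>b<n. F $$ (i, a) * G $$ (a, b) * star_scalar s (H $$ (j, b)))"
      unfolding sum_distrib_right by (rule sum.swap)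
    finally show ?thesis .
  qed
  have "R k * Y (Suc k) * star_mat s (R (k + r)) \<in> carrier_mat n n"
    by (intro mult_carrier_mat[of _ n n] star_mat_carrier R(1) Y)
  then have "sylvester_family s r T R Y k $$ (i, j) =
    (T k * Y k * star_mat s (T (k + r))) $$ (i, j) - (R k * Y (Suc k) * star_mat s (R (k + r))) $$ (i, j)"
    unfolding sylvester_family_def 
    using i j by (intro index_minus_mat) (simp_all only: carrier_matD)
  also have "\<dots> = sylvester (entries Y) k i j"
    unfolding prod[OF T(1) Y T(1)] prod[OF R(1) Y R(1)] sylvester_def sum_subtractf[symmetric]
    using T(2) R(2) i j by (intro sum.cong refl) (simp add: entries_def)
  finally show ?thesis .
qed

lemma twisted_nonsingular_iff:
  assumes T: "\<And>k. T k \<in> carrier_mat n n" "\<And>k. T (k + 2 * r) = T k"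
      "\<And>k i j. i < n \<Longrightarrow> j < n \<Longrightarrow> T k $$ (i, j) = t k i j"
    and R: "\<And>k. R k \<in> carrier_mat n n" "\<And>k. R (k + 2 * r) = R k"
      "\<And>k i j. i < n \<Longrightarrow> j < n \<Longrightarrow> R k $$ (i, j) = u k i j"
  shows "twisted_nonsingular s n r T R \<longleftrightarrow> (\<forall>i<n. \<forall>j<n. nonresonant i j)"
proof -
  have idx: "sylvester_family s r T R Y k $$ (i, j) = sylvester (entries Y) k i j"
    if "\<And>k. Y k \<in> carrier_mat n n" "i < n" "j < n" for Y k i j
    by (rule sylvester_family_index) (use T R that in simp_all)
  show ?thesis
  proof
    assume L: "twisted_nonsingular s n r T R"
    let ?O = "mat_family (\<lambda>_ _ _. 0)"
    have z: "twisted_family s n r ?O" by (rule mat_family_twisted[OF twisted_zero])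
    show "\<forall>i<n. \<forall>j<n. nonresonant i j"
    proof (intro allI impI, rule ccontr)
      fix i j assume "i < n" "j < n" "\<not> nonresonant i j"
      from triangular_kernel[OF this] obtain y k a b where y: "twisted s r y"
        "\<And>k i j. i < n \<Longrightarrow> j < n \<Longrightarrow> sylvester y k i j = 0" and nz: "a < n" "b < n" "y k a b \<noteq> 0"
        by blast
      have ker: "sylvester_family s r T R (mat_family x) = ?O"
        if x: "twisted s r x" "\<And>k i j. i < n \<Longrightarrow> j < n \<Longrightarrow> sylvester x k i j = 0" for x
      proof
        fix k
        note X = mat_family_twisted[OF x(1)]
        have c: "sylvester_family s r T R (mat_family x) k \<in> carrier_mat n n"
          using twisted_familyD(1)[OF twisted_sylvester_family[where M = T and N = R, OF T(1,2) R(1,2) X]] .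
        show "sylvester_family s r T R (mat_family x) k = ?O k"
        proof (rule eq_matI)
          fix i j assume "i < dim_row (?O k)" "j < dim_col (?O k)"
          then have ij: "i < n" "j < n" unfolding mat_family_def by auto
          have "sylvester (entries (mat_family x)) k i j = 0"
            using sylvester_cong[of "entries (mat_family x)" x k i j] entries_mat_family x(2) ij by simp
          then show "sylvester_family s r T R (mat_family x) k $$ (i, j) = ?O k $$ (i, j)"
            using idx[of "mat_family x" i j k] twisted_familyD(1)[OF X] ij by (simp add: mat_family_def)
        qed (use c in \<open>auto simp: mat_family_def\<close>)
      qed
      have "mat_family y = ?O"
        using L z ker[OF y] ker[OF twisted_zero] mat_family_twisted[OF y(1)]
        unfolding twisted_nonsingular_def by auto
      then have "mat_family y k $$ (a, b) = ?O k $$ (a, b)" by simp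
      then show False using nz by (simp add: mat_family_def)
    qed
  next
    assume nr: "\<forall>i<n. \<forall>j<n. nonresonant i j"
    show "twisted_nonsingular s n r T R"
      unfolding twisted_nonsingular_def
    proof (intro allI impI)
      fix E assume E: "twisted_family s n r E"
      obtain y where y: "twisted s r y" "\<And>k i j. i < n \<Longrightarrow> j < n \<Longrightarrow> sylvester y k i j = entries E k i j"
        using triangular_solution[OF _ entries_twisted[OF E]] nr by blast
      note Y = mat_family_twisted[OF y(1)]
      show "\<exists>!Y. twisted_family s n r Y \<and> sylvester_family s r T R Y = E"
      proof (rule ex1I[of _ "mat_family y"], rule conjI[OF Y])
        show "sylvester_family s r T R (mat_family y) = E"
        proof
          fix k
          have c: "sylvester_family s r T R (mat_family y) k \<in> carrier_mat n n"
            using twisted_familyD(1)[OF twisted_sylvester_family[where M = T and N = R, OF T(1,2) R(1,2) Y]] .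
          show "sylvester_family s r T R (mat_family y) k = E k"
          proof (rule eq_matI)
            fix i j assume "i < dim_row (E k)" "j < dim_col (E k)"
            then have ij: "i < n" "j < n" using twisted_familyD(1)[OF E, of k] by auto
            have "sylvester (entries (mat_family y)) k i j = entries E k i j"
              using sylvester_cong[of "entries (mat_family y)" y k i j] entries_mat_family y(2) ij by simp
            then show "sylvester_family s r T R (mat_family y) k $$ (i, j) = E k $$ (i, j)"
              using idx[of "mat_family y" i j k] twisted_familyD(1)[OF Y] ij by (simp add: entries_def)
          qed (use c twisted_familyD(1)[OF E, of k] in auto)
        qed
      next
        fix X assume X: "twisted_family s n r X \<and> sylvester_family s r T R X = E"
        note Xc = twisted_familyD(1)[OF conjunct1[OF X]]
        define z where "z k i j = entries X k i j - y k i j" for k i j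
        have "twisted s r z"
          unfolding twisted_def z_def
          using twistedD[OF y(1)] twistedD[OF entries_twisted[OF conjunct1[OF X]]] by simp
        moreover have "sylvester z k i j = 0" if "i < n" "j < n" for k i j
        proof -
          have "sylvester (entries X) k i j = E k $$ (i, j)" using idx[of X i j k] Xc that X by simp
          then show ?thesis
            using y(2)[OF that, of k] sylvester_minus[of "entries X" y k i j] that
            unfolding z_def by (simp add: entries_def)
        qed
        ultimately have z: "z k i j = 0" if "i < n" "j < n" for k i j
          using triangular_unique[of z i j k] nr that by blast
        show "X = mat_family y"
        proof
          fix k
          show "X k = mat_family y k"
          proof (rule eq_matI)
            fix i j assume "i < dim_row (mat_family y k)" "j < dim_col (mat_family y k)"
            then have "i < n" "j < n" unfolding mat_family_def by auto
            then show "X k $$ (i, j) = mat_family y k $$ (i, j)"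
              using z[of i j k] by (simp add: z_def entries_def mat_family_def)
          qed (use Xc[of k] in \<open>auto simp: mat_family_def\<close>)
        qed
      qed
    qed
  qed
qed

text \<open>
  The cyclic products of the diagonal coefficients are products of the numerators and denominators
  of the eigenvalues. On the diagonal, for the transpose, the half cycle already runs through all
  \<open>2 * r\<close> diagonal entries at \<open>i\<close>, whence the condition \<open>num i \<noteq> den i\<close> without squares.
\<close>

lemma nonresonant_iff:
  defines "num \<equiv> \<lambda>i. \<Prod>k<2 * r. t k i i" and "den \<equiv> \<lambda>i. \<Prod>k<2 * r. u k i i"
  shows "nonresonant i j \<longleftrightarrow>
    (if s = Transpose \<and> i = j then num i \<noteq> den i
     else num i * star_scalar s (num j) \<noteq> den i * star_scalar s (den j))"
proof (cases "s = Transpose \<and> i = j")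
  case True
  then have T: "s = Transpose" and ij: "j = i" by auto
  have st: "star_scalar s z = z" for z using T by simp
  have split: "(\<Prod>k<2 * r. f k) = (\<Prod>k<r. f k * f (k + r))" for f :: "nat \<Rightarrow> complex"
  proof -
    have "(\<Prod>k<m + l. f k) = (\<Prod>k<m. f k) * (\<Prod>k<l. f (k + m))" for m l
      by (induction l) (simp_all add: ac_simps)
    then show ?thesis by (simp add: mult_2 prod.distrib)
  qed
  have "(\<Prod>k<r. lead k i i) = num i" "(\<Prod>k<r. follow k i i) = den i"
    unfolding num_def den_def lead_def follow_def st split by simp_all
  then show ?thesis unfolding if_P[OF True] using nonresonant_diagonal[OF T] ij by simp
next
  case False
  have win: "(\<Prod>k<2 * r. f (k + r)) = (\<Prod>k<2 * r. f k)" if "\<And>k. f (k + 2 * r) = f k" for f :: "nat \<Rightarrow> complex"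
    using prod_period_window[of f "2 * r" r, OF that] by (simp add: add.commute)
  have "(\<Prod>k<2 * r. lead k i j) = num i * star_scalar s (num j)"
    "(\<Prod>k<2 * r. follow k i j) = den i * star_scalar s (den j)"
    unfolding num_def den_def lead_def follow_def prod.distrib star_scalar_prod[symmetric]
    using win[of "\<lambda>k. t k j j"] win[of "\<lambda>k. u k j j"] t_per u_per by simp_all
  then show ?thesis unfolding if_not_P[OF False] nonresonant_otherwise[OF False] by simp
qed

end

section \<open>The spectral conditions\<close>

lemma ext_cnj_divide: "ext_cnj (ext_divide a b) = ext_divide (cnj a) (cnj b)"
  unfolding ext_divide_def by simp

text \<open>
  In homogeneous coordinates, \<open>a : b\<close> and \<open>d : c\<close> are the same point of the extended plane.
\<close>

lemma ext_divide_eq_inverse_iff: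
  assumes "a \<noteq> 0 \<or> b \<noteq> 0" "c \<noteq> 0 \<or> d \<noteq> 0"
  shows "ext_divide a b = ext_inverse (ext_divide c d) \<longleftrightarrow> a * c = b * d"
  using assms unfolding ext_divide_def by (auto simp: field_simps)

lemma ext_divide_eq_minus_one_iff: "ext_divide a b = Fin (- 1) \<longleftrightarrow> b \<noteq> 0 \<and> a = - b"
  unfolding ext_divide_def by (auto simp: field_simps)

lemma adjoint_spectral_condition:
  fixes a b :: "nat \<Rightarrow> complex"
  shows "(\<forall>i<n. \<forall>j<n. a i * cnj (a j) \<noteq> b i * cnj (b j)) \<longleftrightarrow>
    \<not> (\<exists>i<n. a i = 0 \<and> b i = 0) \<and> H_reciprocal_free ((\<lambda>i. ext_divide (a i) (b i)) ` {0..<n})"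
proof (cases "\<exists>i<n. a i = 0 \<and> b i = 0")
  case True
  then obtain i where "i < n" "a i = 0" "b i = 0" by blast
  then have "\<not> (\<forall>i<n. \<forall>j<n. a i * cnj (a j) \<noteq> b i * cnj (b j))" by force
  then show ?thesis using True by blast
next
  case False
  then have "ext_divide (a i) (b i) = ext_inverse (ext_cnj (ext_divide (a j) (b j))) \<longleftrightarrow>
    a i * cnj (a j) = b i * cnj (b j)" if "i < n" "j < n" for i j
    unfolding ext_cnj_divide using that by (intro ext_divide_eq_inverse_iff) auto
  then show ?thesis using False unfolding H_reciprocal_free_def by auto
qed

text \<open>
  An eigenvalue equal to its own reciprocal is \<open>1\<close> or \<open>- 1\<close>. The condition \<open>a i \<noteq> b i\<close> excludes \<open>1\<close> but
  allows \<open>- 1\<close>, and the condition for \<open>i \<noteq> j\<close> excludes that \<open>- 1\<close> occurs twice.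
\<close>

lemma transpose_spectral_condition:
  fixes a b :: "nat \<Rightarrow> complex"
  defines "ev \<equiv> \<lambda>i. ext_divide (a i) (b i)"
  shows "(\<forall>i<n. \<forall>j<n. if i = j then a i \<noteq> b i else a i * a j \<noteq> b i * b j) \<longleftrightarrow>
    \<not> (\<exists>i<n. a i = 0 \<and> b i = 0) \<and> reciprocal_free (ev ` {0..<n} - {Fin (- 1)}) \<and>
    card {i. i < n \<and> ev i = Fin (- 1)} \<le> 1"
proof (cases "\<exists>i<n. a i = 0 \<and> b i = 0")
  case True
  then obtain i where "i < n" "a i = 0" "b i = 0" by blast
  then have "\<not> (\<forall>i<n. \<forall>j<n. if i = j then a i \<noteq> b i else a i * a j \<noteq> b i * b j)" by force
  then show ?thesis using True by blast
next
  case False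
  then have reg: "a i \<noteq> 0 \<or> b i \<noteq> 0" if "i < n" for i using that by blast
  have inv: "ev i = ext_inverse (ev j) \<longleftrightarrow> a i * a j = b i * b j" if "i < n" "j < n" for i j
    unfolding ev_def using reg that by (intro ext_divide_eq_inverse_iff) auto
  have m1: "ev i = Fin (- 1) \<longleftrightarrow> a i = - b i" if "i < n" for i
    unfolding ev_def ext_divide_eq_minus_one_iff using reg[OF that] by auto
  have card: "card {i. i < n \<and> ev i = Fin (- 1)} \<le> 1 \<longleftrightarrow>
    (\<forall>i<n. \<forall>j<n. ev i = Fin (- 1) \<longrightarrow> ev j = Fin (- 1) \<longrightarrow> i = j)"
    by (simp add: card_le_Suc0_iff_eq) blast
  have rf: "reciprocal_free (ev ` {0..<n} - {Fin (- 1)}) \<longleftrightarrow>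
    (\<forall>i<n. \<forall>j<n. a i \<noteq> - b i \<longrightarrow> a j \<noteq> - b j \<longrightarrow> a i * a j \<noteq> b i * b j)"
  proof -
    have "reciprocal_free (ev ` {0..<n} - {Fin (- 1)}) \<longleftrightarrow>
      (\<forall>i<n. \<forall>j<n. ev i \<noteq> Fin (- 1) \<longrightarrow> ev j \<noteq> Fin (- 1) \<longrightarrow> ev i \<noteq> ext_inverse (ev j))"
    proof -
      have S: "ev ` {0..<n} - {Fin (- 1)} = ev ` {i. i < n \<and> ev i \<noteq> Fin (- 1)}" by auto
      show ?thesis unfolding reciprocal_free_def S ball_simps mem_Collect_eq by blast
    qed
    then show ?thesis by (simp add: inv m1)
  qed
  show ?thesis
  proof
    assume L: "\<forall>i<n. \<forall>j<n. if i = j then a i \<noteq> b i else a i * a j \<noteq> b i * b j"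
    have "a i * a j \<noteq> b i * b j" if "i < n" "j < n" "a i \<noteq> - b i" for i j
    proof (cases "i = j")
      case True
      then show ?thesis using L that square_eq_iff[of "a i" "b i"] by auto
    qed (use L that in simp)
    moreover have "i = j" if "i < n" "j < n" "a i = - b i" "a j = - b j" for i j
    proof (rule ccontr)
      assume "i \<noteq> j"
      then have "a i * a j \<noteq> b i * b j" using L that(1,2) by simp
      then show False using that(3,4) by simp
    qed
    ultimately show "\<not> (\<exists>i<n. a i = 0 \<and> b i = 0) \<and> reciprocal_free (ev ` {0..<n} - {Fin (- 1)}) \<and>
      card {i. i < n \<and> ev i = Fin (- 1)} \<le> 1"
      using False unfolding rf card using m1 by blast
  next
    assume R: "\<not> (\<exists>i<n. a i = 0 \<and> b i = 0) \<and> reciprocal_free (ev ` {0..<n} - {Fin (- 1)}) \<and>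
      card {i. i < n \<and> ev i = Fin (- 1)} \<le> 1"
    then have free: "a i * a j \<noteq> b i * b j" if "i < n" "j < n" "a i \<noteq> - b i" "a j \<noteq> - b j" for i j
      using that unfolding rf by blast
    have single: "i = j" if "i < n" "j < n" "a i = - b i" "a j = - b j" for i j
      using R that m1 unfolding card by blast
    show "\<forall>i<n. \<forall>j<n. if i = j then a i \<noteq> b i else a i * a j \<noteq> b i * b j"
    proof (intro allI impI)
      fix i j assume ij: "i < n" "j < n"
      have diag: "a i \<noteq> b i"
      proof
        assume "a i = b i"
        then show False using free[of i i] reg[of i] ij by auto
      qed
      have off: "a i * a j \<noteq> b i * b j" if "i \<noteq> j"
      proof
        assume eq: "a i * a j = b i * b j"
        have "a i = - b i \<longleftrightarrow> a j = - b j"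
        proof -
          have flip: "z = - w" if "x = - y" "x * z = y * w" "x \<noteq> 0 \<or> y \<noteq> 0" for x y z w :: complex
          proof -
            have "y * (- z) = y * w" "y \<noteq> 0" using that by auto
            then have "- z = w" using mult_left_cancel[of y "- z" w] by blast
            then show ?thesis by (metis minus_minus)
          qed
          have "a j * a i = b j * b i" using eq by (simp add: mult.commute)
          then show ?thesis using flip[of "a i" "b i" "a j" "b j"] flip[of "a j" "b j" "a i" "b i"]
            eq reg[OF ij(1)] reg[OF ij(2)] by blast
        qed
        then show False using eq free[OF ij] single[OF ij] that by blast
      qed
      show "if i = j then a i \<noteq> b i else a i * a j \<noteq> b i * b j"
      proof (cases "i = j")
        case True
        then show ?thesis unfolding if_P[OF True] using diag by blast
      next
        case False
        then show ?thesis unfolding if_not_P[OF False] by (rule off)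
      qed
    qed
  qed
qed

section \<open>Nonsingularity and the spectrum\<close>

theorem theorem6:
  fixes s :: star_op and n r :: nat and A B C D M N :: "nat \<Rightarrow> complex mat"
  assumes "n \<ge> 1" and "r \<ge> 1"
    and "\<And>k. k \<in> {1..r} \<Longrightarrow> A k \<in> carrier_mat n n"
    and "\<And>k. k \<in> {1..r} \<Longrightarrow> B k \<in> carrier_mat n n"
    and "\<And>k. k \<in> {1..r} \<Longrightarrow> C k \<in> carrier_mat n n"
    and "\<And>k. k \<in> {1..r} \<Longrightarrow> D k \<in> carrier_mat n n"
  defines "M \<equiv> join_star s r A B" and "N \<equiv> join_star s r C D"
  shows "nonsingular_system s n r A B C D \<longleftrightarrow>
    regular_product n (2 * r) M N \<and>
    (s = Adjoint \<longrightarrow> H_reciprocal_free (product_spectrum n (2 * r) M N)) \<and>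
    (s = Transpose \<longrightarrow>
       reciprocal_free (product_spectrum n (2 * r) M N - {Fin (-1)}) \<and>
       product_multiplicity n (2 * r) M N (Fin (-1)) \<le> 1)"
proof -
  have r: "0 < r" and p: "0 < 2 * r" using assms(2) by simp_all
  have M: "M k \<in> carrier_mat n n" and N: "N k \<in> carrier_mat n n" if "k \<in> {1..2 * r}" for k
    unfolding M_def N_def 

    using join_star_carrier[of r A n B k s] join_star_carrier[of r C n D k s] assms(3-6) that by blast+
  define T R where "T = fst (schur_factors n (2 * r) M N)" and "R = snd (schur_factors n (2 * r) M N)"
  define is_schur where
    "is_schur TR \<longleftrightarrow> (\<exists>Q Z. periodic_schur n (2 * r) M N Q Z (fst TR) (snd TR))" for TR
  have factors: "schur_factors n (2 * r) M N = (SOME TR. is_schur TR)"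
    unfolding schur_factors_def is_schur_def ..
  have "\<exists>Q Z T R. periodic_schur n (2 * r) M N Q Z T R"
    by (rule periodic_schur_decomposition[OF p M N])
  then have "\<exists>TR. is_schur TR" unfolding is_schur_def by auto
  then have "is_schur (schur_factors n (2 * r) M N)" unfolding factors by (rule someI_ex)
  then obtain Q Z where QZ: "periodic_schur n (2 * r) M N Q Z T R"
    unfolding is_schur_def T_def R_def by blast
  \<comment> \<open>From here on all families are indexed from \<open>0\<close> and extended with period \<open>2 * r\<close>.\<close>
  define c where "c k = Suc (k mod (2 * r))" for k
  have c: "c k \<in> {1..2 * r}" "c (k + 2 * r) = c k" for k
    unfolding c_def using p by (simp_all add: Suc_le_eq)
  have Z_next: "Z (Suc (c k)) = Z (c (Suc k))" for k
  proof (cases "Suc (k mod (2 * r)) = 2 * r")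
    case True
    then have "c (Suc k) = 1" unfolding c_def by (simp add: mod_Suc)
    moreover have "Suc (c k) = 2 * r + 1" unfolding c_def using True by simp
    ultimately show ?thesis using QZ unfolding periodic_schur_def by metis
  next
    case False
    then show ?thesis unfolding c_def by (simp add: mod_Suc)
  qed
  have schur: "unitary_mat n (Q (c k))" "unitary_mat n (Z (c k))"
    "T (c k) = mat_adjoint (Q (c k)) * M (c k) * Z (c k)" "upper_triangular (T (c k))"
    "R (c k) = mat_adjoint (Q (c k)) * N (c k) * Z (c (Suc k))" "upper_triangular (R (c k))" for k
    using bspec[OF conjunct2[OF QZ[unfolded periodic_schur_def]] c(1), of k] Z_next[of k] by simp_all
  have carrier: "T (c k) \<in> carrier_mat n n" "R (c k) \<in> carrier_mat n n" for k
    unfolding schur(3,5)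
    by (intro mult_carrier_mat[of _ n n] adjoint_carrier unitary_carrier schur(1,2) M N c(1))+
  interpret triangular_star_system s n r "\<lambda>k i j. T (c k) $$ (i, j)" "\<lambda>k i j. R (c k) $$ (i, j)"
  proof
    show "T (c k) $$ (i, j) = 0" "R (c k) $$ (i, j) = 0" if "j < i" "i < n" for i j k
      using upper_triangularD[OF schur(4)] upper_triangularD[OF schur(6)] carrier[of k] that by auto
  qed (use r c(2) in simp_all)
  have "nonsingular_system s n r A B C D \<longleftrightarrow> twisted_nonsingular s n r (\<lambda>k. M (c k)) (\<lambda>k. N (c k))"
    unfolding M_def N_def c_def by (rule nonsingular_iff_twisted_nonsingular[OF r assms(3-6)])
  also have "\<dots> \<longleftrightarrow> twisted_nonsingular s n r (\<lambda>k. T (c k)) (\<lambda>k. R (c k))"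
    unfolding schur(3,5)
    by (rule twisted_nonsingular_conj[OF r, symmetric]) (use schur(1,2) M N c in simp_all)
  also have "\<dots> \<longleftrightarrow> (\<forall>i<n. \<forall>j<n. nonresonant i j)"
    by (rule twisted_nonsingular_iff) (use carrier c in simp_all)
  also have "\<dots> \<longleftrightarrow> (\<forall>i<n. \<forall>j<n. if s = Transpose \<and> i = j
      then num_diag n (2 * r) M N i \<noteq> den_diag n (2 * r) M N i
      else num_diag n (2 * r) M N i * star_scalar s (num_diag n (2 * r) M N j) \<noteq>
        den_diag n (2 * r) M N i * star_scalar s (den_diag n (2 * r) M N j))"
  proof -
    have shift: "(\<Prod>k=1..2 * r. F k) = (\<Prod>k<2 * r. F (c k))" for F :: "nat \<Rightarrow> complex"
    proof -
      have "(\<Prod>k=1..2 * r. F k) = (\<Prod>k<2 * r. F (Suc k))"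
        by (rule prod.reindex_bij_witness[of _ Suc "\<lambda>k. k - 1"]) auto
      then show ?thesis unfolding c_def by simp
    qed
    show ?thesis
      unfolding num_diag_def den_diag_def T_def[symmetric] R_def[symmetric] shift nonresonant_iff ..
  qed
  also have "\<dots> \<longleftrightarrow>
    regular_product n (2 * r) M N \<and>
    (s = Adjoint \<longrightarrow> H_reciprocal_free (product_spectrum n (2 * r) M N)) \<and>
    (s = Transpose \<longrightarrow>
       reciprocal_free (product_spectrum n (2 * r) M N - {Fin (-1)}) \<and>
       product_multiplicity n (2 * r) M N (Fin (-1)) \<le> 1)"
  proof (cases s)
    case Transpose
    show ?thesis
      using transpose_spectral_condition[of n "num_diag n (2 * r) M N" "den_diag n (2 * r) M N"]
      unfolding Transpose star_scalar.simps regular_product_def product_spectrum_def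
        product_multiplicity_def product_eigenvalue_def
      by (simp only: simp_thms star_op.distinct)
  next
    case Adjoint
    show ?thesis
      using adjoint_spectral_condition[of n "num_diag n (2 * r) M N" "den_diag n (2 * r) M N"]
      unfolding Adjoint star_scalar.simps regular_product_def product_spectrum_def product_eigenvalue_def
      by (simp only: simp_thms star_op.distinct if_False)
  qed
  finally show ?thesis .
qed

end
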